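(* Let $f(x)$ be an Artinian (resp. Noetherian) delta series whose leading coefficient is a positive real number. Then for all real numbers $a$ and $b$, $$a\,[x^{a}]\left(f^{(-1;0)}(x)\right)^{b;0}=b\,[x^{a-b}]\left(\frac{x}{f(x)}\right)^{a;0}.$$
   Context: Coefficients: $K$ is $\mathbb C$, or a field obtained from $\mathbb C$ by finitely many times replacing a field $L$ by $L(y)^{\mathbb R}$ or $L(y)_{\mathbb R}$ in a new variable $y$ (defined as follows). Series: the Artinian algebra $K(x)^{\mathbb R}$ is the set of formal sums $f(x)=\sum_{a\in\mathbb R}c_ax^a$, $c_a\in K$, such that for every $a\in\mathbb R$ there are only finitely many $b\le a$ with $c_b\ne0$; its elements are Artinian series. The Noetherian algebra $K(x)_{\mathbb R}$ is defined in the same way with $b\ge a$; its elements are Noetherian series. Addition is termwise and $(\sum c_ax^a)(\sum d_bx^b)=\sum_e(\sum_{a+b=e}c_ad_b)x^e$; with these operations they are fields. $[x^a]f(x)=c_a$. The degree $\deg f$ of a nonzero series is $\min\{a:c_a\ne0\}$ (Artinian) or $\max\{a:c_a\ne0\}$ (Noetherian); $c_{\deg f}$ is the leading coefficient. A delta series is a series of degree one. Powers: for nonzero $z\in\mathbb C$ write $z=|z|e^{i\theta}$ with $0\le\theta<2\pi$; for $t\in\mathbb R$, $n\in\mathbb Z$ put $z^{t;n}=|z|^te^{it(\theta+2n\pi)}$. For a nonzero series $g=\sum c_ax^a$ of degree $d$ put, recursively, $$g(x)^{t;n}=c_d^{t;n}x^{dt}\sum_M\binom tM\prod_{a\in M}\frac{c_{a+d}}{c_d}x^a,$$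 the sum being over all finite multisets $M$ of nonzero real numbers, products taken with multiplicity, and $\binom tM=\frac{t(t-1)\cdots(t+1-|M|)}{\prod_jM(j)!}$, where $M(j)$ is the multiplicity of $j$ and $|M|=\sum_jM(j)$. Composition: for $f(x)=\sum_ac_ax^a$ and a nonzero $g(x)$ of positive degree (both Artinian or both Noetherian) and $n\in\mathbb Z$, $f(g;n)=\sum_ac_a\,g(x)^{a;n}$. Compositional inverse: $F=f^{(-1;0)}$ denotes the inverse of $f$ with respect to $0$-composition, i.e. the delta series $F$ (Artinian, resp. Noetherian) with $F(f;0)=x=f(F;0)$. *)

theory Defs
  imports "HOL-Analysis.Complex_Transcendental" "HOL-Algebra.Ring" "HOL-Library.Multiset"
begin

datatype kind = Artinian | Noetherian

text \<open>
  A ring together with the constants coming from \<open>\<complex>\<close> and the power operation \<open>z, t, n \<mapsto> z\<^sup>t\<^sup>;\<^sup>n\<close>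
  (meaningful for nonzero \<open>z\<close> only).
\<close>

record 'k power_ring = "'k ring" +
  const :: "complex \<Rightarrow> 'k"
  gpow :: "'k \<Rightarrow> real \<Rightarrow> int \<Rightarrow> 'k"

text \<open>\<open>Arg2pi\<close> takes its values in \<open>[0, 2\<pi>)\<close>.\<close>

definition cpow :: "complex \<Rightarrow> real \<Rightarrow> int \<Rightarrow> complex" where
  "cpow z t n = complex_of_real (cmod z powr t) * cis (t * (Arg2pi z + 2 * of_int n * pi))"

definition complex_field :: "complex power_ring" where
  "complex_field = \<lparr>carrier = UNIV, mult = (*), one = 1, zero = 0, add = (+),
     const = (\<lambda>z. z), gpow = cpow\<rparr>"


text \<open>
  Formal sums, possibly over an infinite index set: only the nonzero terms are added up
  (\<open>finsum\<close> itself is zero on every infinite index set).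
\<close>

definition fsum :: "('k, 'm) ring_scheme \<Rightarrow> ('i \<Rightarrow> 'k) \<Rightarrow> 'i set \<Rightarrow> 'k" where
  "fsum R h I = finsum R h {i \<in> I. h i \<noteq> \<zero>\<^bsub>R\<^esub>}"

text \<open>
  The series \<open>\<Sum>a. c\<^sub>a x\<^sup>a\<close> is the function \<open>a \<mapsto> c\<^sub>a\<close>; thus \<open>f a\<close> is \<open>[x\<^sup>a] f\<close>.
\<close>

definition series_set :: "kind \<Rightarrow> ('k, 'm) ring_scheme \<Rightarrow> (real \<Rightarrow> 'k) set" where
  "series_set k R = {f. (\<forall>a. f a \<in> carrier R) \<and>
     (\<forall>a. finite {b. (case k of Artinian \<Rightarrow> b \<le> a | Noetherian \<Rightarrow> b \<ge> a) \<and> f b \<noteq> \<zero>\<^bsub>R\<^esub>})}"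

definition monomial :: "('k, 'm) ring_scheme \<Rightarrow> 'k \<Rightarrow> real \<Rightarrow> real \<Rightarrow> 'k" where
  "monomial R c a = (\<lambda>e. if e = a then c else \<zero>\<^bsub>R\<^esub>)"

definition series_mult ::
    "('k, 'm) ring_scheme \<Rightarrow> (real \<Rightarrow> 'k) \<Rightarrow> (real \<Rightarrow> 'k) \<Rightarrow> real \<Rightarrow> 'k" where
  "series_mult R f g = (\<lambda>e. fsum R (\<lambda>(a, b). f a \<otimes>\<^bsub>R\<^esub> g b) {(a, b). a + b = e})"

definition series_sum :: "('k, 'm) ring_scheme \<Rightarrow> ('i \<Rightarrow> real \<Rightarrow> 'k) \<Rightarrow> 'i set \<Rightarrow> real \<Rightarrow> 'k" where
  "series_sum R h I = (\<lambda>e. fsum R (\<lambda>i. h i e) I)"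

definition series_deg :: "kind \<Rightarrow> ('k, 'm) ring_scheme \<Rightarrow> (real \<Rightarrow> 'k) \<Rightarrow> real" where
  "series_deg k R f = (case k of
     Artinian \<Rightarrow> (LEAST a. f a \<noteq> \<zero>\<^bsub>R\<^esub>) | Noetherian \<Rightarrow> (GREATEST a. f a \<noteq> \<zero>\<^bsub>R\<^esub>))"

definition series_lead :: "kind \<Rightarrow> ('k, 'm) ring_scheme \<Rightarrow> (real \<Rightarrow> 'k) \<Rightarrow> 'k" where
  "series_lead k R f = f (series_deg k R f)"

definition mset_binomial :: "real \<Rightarrow> real multiset \<Rightarrow> real" where
  "mset_binomial t M = (\<Prod>i<size M. t - real i) / (\<Prod>j\<in>set_mset M. fact (count M j))"

definition series_pow ::
    "kind \<Rightarrow> ('k, 'm) power_ring_scheme \<Rightarrow> (real \<Rightarrow> 'k) \<Rightarrow> real \<Rightarrow> int \<Rightarrow> real \<Rightarrow> 'k" where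
  "series_pow k R g t n =
     (let d = series_deg k R g in
      series_mult R (monomial R (gpow R (g d) t n) (d * t))
        (series_sum R
          (\<lambda>M. monomial R
             (const R (of_real (mset_binomial t M)) \<otimes>\<^bsub>R\<^esub>
               (\<Otimes>\<^bsub>R\<^esub>a\<in>set_mset M. (g (a + d) \<otimes>\<^bsub>R\<^esub> inv\<^bsub>R\<^esub> (g d)) [^]\<^bsub>R\<^esub> count M a))
             (\<Sum>\<^sub># M))
          {M. 0 \<notin># M}))"

definition series_field :: "kind \<Rightarrow> ('k, 'm) power_ring_scheme \<Rightarrow> (real \<Rightarrow> 'k) power_ring" where
  "series_field k R = \<lparr>carrier = series_set k R, mult = series_mult R,
     one = monomial R \<one>\<^bsub>R\<^esub> 0, zero = (\<lambda>_. \<zero>\<^bsub>R\<^esub>), add = (\<lambda>f g a. f a \<oplus>\<^bsub>R\<^esub> g a),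
     const = (\<lambda>z. monomial R (const R z) 0), gpow = series_pow k R\<rparr>"

text \<open>
  The iterated series fields over \<open>\<complex>\<close> live over different types \<open>real \<Rightarrow> \<dots> \<Rightarrow> real \<Rightarrow> complex\<close>.
  So that one can quantify over all of them, they are copied into the following type along
  its constructors. The head of the list of kinds belongs to the variable adjoined last.
\<close>

datatype nested = Cplx (the_cplx: complex) | Series (the_series: "real \<Rightarrow> nested")

definition transport :: "('a \<Rightarrow> 'b) \<Rightarrow> ('b \<Rightarrow> 'a) \<Rightarrow> ('a, 'm) power_ring_scheme \<Rightarrow> 'b power_ring" where
  "transport h h' R = \<lparr>carrier = h ` carrier R,
     mult = (\<lambda>x y. h (h' x \<otimes>\<^bsub>R\<^esub> h' y)), one = h \<one>\<^bsub>R\<^esub>, zero = h \<zero>\<^bsub>R\<^esub>,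
     add = (\<lambda>x y. h (h' x \<oplus>\<^bsub>R\<^esub> h' y)),
     const = (\<lambda>z. h (const R z)), gpow = (\<lambda>x t n. h (gpow R (h' x) t n))\<rparr>"

primrec coeff_field :: "kind list \<Rightarrow> nested power_ring" where
  "coeff_field [] = transport Cplx the_cplx complex_field"
| "coeff_field (k # ks) = transport Series the_series (series_field k (coeff_field ks))"


definition delta_series :: "kind \<Rightarrow> ('k, 'm) power_ring_scheme \<Rightarrow> (real \<Rightarrow> 'k) \<Rightarrow> bool" where
  "delta_series k R f \<longleftrightarrow>
     f \<in> carrier (series_field k R) \<and> f \<noteq> \<zero>\<^bsub>series_field k R\<^esub> \<and> series_deg k R f = 1"

abbreviation var :: "('k, 'm) power_ring_scheme \<Rightarrow> real \<Rightarrow> 'k" where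
  "var R \<equiv> monomial R \<one>\<^bsub>R\<^esub> 1"

text \<open>\<open>f(g; n)\<close>, meaningful for nonzero \<open>g\<close> of positive degree.\<close>

definition series_compose ::
    "kind \<Rightarrow> ('k, 'm) power_ring_scheme \<Rightarrow> (real \<Rightarrow> 'k) \<Rightarrow> (real \<Rightarrow> 'k) \<Rightarrow> int \<Rightarrow> real \<Rightarrow> 'k" where
  "series_compose k R f g n = series_sum R (\<lambda>a e. f a \<otimes>\<^bsub>R\<^esub> series_pow k R g a n e) UNIV"

definition comp_inverse :: "kind \<Rightarrow> ('k, 'm) power_ring_scheme \<Rightarrow> (real \<Rightarrow> 'k) \<Rightarrow> real \<Rightarrow> 'k" where
  "comp_inverse k R f =
     (THE F. delta_series k R F \<and> series_compose k R F f 0 = var R \<and> series_compose k R f F 0 = var R)"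

end

theory Submission
  imports Defs
begin

text \<open>
  Why the formula holds. Let \<open>\<theta> = x d/dx\<close>. The residue \<open>h \<mapsto> [x\<^sup>0] h\<close> vanishes on derivatives
  \<open>\<theta> h\<close>, and it is invariant under a change of variable:
  \<open>[x\<^sup>0] (h(f) \<cdot> \<theta> f / f) = [x\<^sup>0] h\<close>. On \<open>h = x\<^sup>a\<close> with \<open>a \<noteq> 0\<close> this is because \<open>f\<^sup>a \<theta> f / f = \<theta>(f\<^sup>a) / a\<close>,
  and on \<open>h = 1\<close> because \<open>\<theta> f / f\<close> has constant term \<open>deg f = 1\<close>. Hence, with the chain rule,
  \<open>a [x\<^sup>a] h = [x\<^sup>0] (x\<^sup>-\<^sup>a \<theta> h) = [x\<^sup>0] (f\<^sup>-\<^sup>a (\<theta> h)(f) \<theta> f / f) = [x\<^sup>0] (f\<^sup>-\<^sup>a \<theta> (h(f)))\<close>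
  (\<open>lagrange_coeff\<close>). For \<open>h = F\<^sup>b\<close>, where \<open>F\<close> is the compositional inverse, \<open>h(f) = x\<^sup>b\<close>, and the right-hand
  side is \<open>b [x\<^sup>-\<^sup>b] f\<^sup>-\<^sup>a = b [x\<^sup>a\<^sup>-\<^sup>b] (x/f)\<^sup>a\<close>.

  The same formula produces \<open>F\<close>: the series with \<open>a [x\<^sup>a] F = [x\<^sup>-\<^sup>1] f\<^sup>-\<^sup>a\<close> and a suitable constant term satisfies
  \<open>F(f) = x\<close>, because a series is determined by its pairings with all the \<open>f\<^sup>-\<^sup>a\<close> (\<open>ex_substitute_eq_monom\<close>). That \<open>F\<^sup>b(f) = x\<^sup>b\<close>, and
  all laws for powers, follow from one principle: up to a constant factor, a power \<open>g\<^sup>t\<close> is the only solution \<open>y\<close> of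
  \<open>g \<theta> y = t y \<theta> g\<close>. The sum over multisets that defines \<open>(1 + u)\<^sup>t\<close> solves this equation because
  \<open>M(j) \<cdot> binom(t, M) = (t - |N|) \<cdot> binom(t, N)\<close> whenever \<open>M\<close> arises from \<open>N\<close> by adding \<open>j\<close>
  (\<open>mset_binomial_add_mset\<close>, \<open>mset_series_marked\<close>). Identities between additive maps which are continuous for the
  order filtration only have to be checked on monomials (\<open>cts_additive_ext\<close>); this disposes of the infinite sums in
  \<open>h(f)\<close>.

  Two reductions allow this argument to be carried out once, with ordinary type-class algebra. Both kinds of series are
  Artinian after the substitution \<open>x \<mapsto> 1/x\<close> in the Noetherian case, which turns degree \<open>1\<close> into
  degree \<open>s = -1\<close>; so the calculus is developed for a one-parameter group \<open>A\<close> of Artinian series where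
  \<open>A\<^sub>a\<close> has degree \<open>a\<close>, to be applied to \<open>A\<^sub>a = f\<^sup>s\<^sup>a\<close> (locale \<open>power_group\<close>). And the only coefficients that are
  ever inverted are real constants, so that the argument makes sense over any commutative \<open>\<real>\<close>-algebra.
  Therefore the coefficient fields, which are sets inside the type \<open>nested\<close>, can all be replaced by
  one type: the product of all suitable rings inside \<open>nested\<close>, of which each of them is a quotient (type
  \<open>ring_product\<close>). Series over a coefficient ring \<open>K\<close> are images of series over this product, and the operations
  of \<open>series_field\<close> are images of the typed ones (\<open>series_of\<close> and the lemmas about it).
\<close>

section \<open>Artinian series over a commutative real algebra\<close>

class real_comm_algebra_1 = real_algebra_1 + comm_ring_1

typedef (overloaded) 'k aseries = "{f :: real \<Rightarrow> 'k::zero. \<forall>c. finite {a. a \<le> c \<and> f a \<noteq> 0}}"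
  morphisms coeff Abs_aseries
  by (rule exI[of _ "\<lambda>_. 0"]) simp

lemma finite_coeff: "finite {a. a \<le> c \<and> coeff f a \<noteq> 0}"
  using coeff[of f] by simp

lemma aseries_eqI: "(\<And>a. coeff f a = coeff g a) \<Longrightarrow> f = g"
  by (metis coeff_inverse ext)

lemma coeff_Abs_aseries:
  "(\<And>c. finite {a. a \<le> c \<and> f a \<noteq> 0}) \<Longrightarrow> coeff (Abs_aseries f) = f"
  by (simp add: Abs_aseries_inverse)

text \<open>
  The order filtration. It gives the topology in which the formal infinite sums converge.
\<close>

definition order_ge :: "real \<Rightarrow> 'k::zero aseries \<Rightarrow> bool" where
  "order_ge m f \<longleftrightarrow> (\<forall>a<m. coeff f a = 0)"

lemma order_geD: "order_ge m f \<Longrightarrow> a < m \<Longrightarrow> coeff f a = 0"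
  by (simp add: order_ge_def)

lemma ex_least_exponent:
  assumes "f \<noteq> Abs_aseries (\<lambda>_. 0)"
  obtains d where "coeff f d \<noteq> 0" "order_ge d f"
proof -
  obtain a where a: "coeff f a \<noteq> 0"
    using assms by (metis coeff_inverse ext)
  let ?S = "{b. b \<le> a \<and> coeff f b \<noteq> 0}"
  have ne: "?S \<noteq> {}" using a by auto
  define d where "d = Min ?S"
  have "d \<in> ?S" unfolding d_def by (rule Min_in[OF finite_coeff ne])
  moreover have "coeff f b = 0" if "b < d" for b
  proof (rule ccontr)
    assume "coeff f b \<noteq> 0"
    then have "b \<in> ?S" using that \<open>d \<in> ?S\<close> by simp
    then have "d \<le> b" unfolding d_def by (rule Min_le[OF finite_coeff])
    then show False using that by simp
  qed
  ultimately show ?thesis using that[of d] by (simp add: order_ge_def)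
qed

lemma ex_order_ge:
  obtains m where "order_ge m f"
proof (cases "f = Abs_aseries (\<lambda>_. 0)")
  case True
  then show ?thesis using that[of 0] by (simp add: order_ge_def coeff_Abs_aseries)
next
  case False
  then show ?thesis using that ex_least_exponent by blast
qed

instantiation aseries :: (ab_group_add) ab_group_add
begin
definition "0 = Abs_aseries (\<lambda>_. 0)"
definition "f + g = Abs_aseries (\<lambda>a. coeff f a + coeff g a)"
definition "- f = Abs_aseries (\<lambda>a. - coeff f a)"
definition "f - g = Abs_aseries (\<lambda>a. coeff f a - coeff g a)"

lemma coeff_zero [simp]: "coeff 0 a = 0"
  by (simp add: zero_aseries_def coeff_Abs_aseries)

lemma coeff_add [simp]: "coeff (f + g) a = coeff f a + coeff g a"
  unfolding plus_aseries_def
  by (subst coeff_Abs_aseries)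
     (auto intro: finite_subset[OF _ finite_UnI[OF finite_coeff[of _ f] finite_coeff[of _ g]]])

lemma coeff_uminus [simp]: "coeff (- f) a = - coeff f a"
  unfolding uminus_aseries_def
  by (subst coeff_Abs_aseries) (auto simp: finite_coeff)

lemma coeff_diff [simp]: "coeff (f - g) a = coeff f a - coeff g a"
  unfolding minus_aseries_def
  by (subst coeff_Abs_aseries)
     (auto intro: finite_subset[OF _ finite_UnI[OF finite_coeff[of _ f] finite_coeff[of _ g]]])

instance by standard (auto intro!: aseries_eqI simp: algebra_simps)
end

lemma coeff_sum [simp]: "coeff (sum F I) a = (\<Sum>i\<in>I. coeff (F i) a)"
  by (induction I rule: infinite_finite_induct) auto

lemma ex_leading:
  assumes "f \<noteq> (0 :: 'k::ab_group_add aseries)"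
  obtains d where "coeff f d \<noteq> 0" "order_ge d f"
  using ex_least_exponent assms by (metis zero_aseries_def)

definition monom :: "'k::ab_group_add \<Rightarrow> real \<Rightarrow> 'k aseries" where
  "monom c a = Abs_aseries (\<lambda>b. if b = a then c else 0)"

lemma coeff_monom [simp]: "coeff (monom c a) b = (if b = a then c else 0)"
  unfolding monom_def by (subst coeff_Abs_aseries) (auto intro: finite_subset[of _ "{a}"])

lemma finite_mult_support:
  fixes f g :: "'k::ab_group_add aseries"
  shows "finite {a. coeff f a \<noteq> 0 \<and> coeff g (e - a) \<noteq> 0}"
proof -
  obtain n where n: "order_ge n g" by (rule ex_order_ge)
  have "{a. coeff f a \<noteq> 0 \<and> coeff g (e - a) \<noteq> 0} \<subseteq> {a. a \<le> e - n \<and> coeff f a \<noteq> 0}"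
    using order_geD[OF n] by force
  then show ?thesis using finite_coeff finite_subset by blast
qed

instantiation aseries :: (comm_ring_1) comm_ring_1
begin
definition "1 = monom 1 0"
definition "f * g =
  Abs_aseries (\<lambda>e. \<Sum>a | coeff f a \<noteq> 0 \<and> coeff g (e - a) \<noteq> 0. coeff f a * coeff g (e - a))"

lemma coeff_mult':
  fixes f g :: "'a aseries"
  shows "coeff (f * g) e = (\<Sum>a | coeff f a \<noteq> 0 \<and> coeff g (e - a) \<noteq> 0. coeff f a * coeff g (e - a))"
proof -
  obtain m n where mn: "order_ge m f" "order_ge n g" by (metis ex_order_ge)
  have "{e. e \<le> c \<and> (\<Sum>a | coeff f a \<noteq> 0 \<and> coeff g (e - a) \<noteq> 0. coeff f a * coeff g (e - a)) \<noteq> 0}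
    \<subseteq> (\<lambda>(a, b). a + b) ` ({a. a \<le> c - n \<and> coeff f a \<noteq> 0} \<times> {b. b \<le> c - m \<and> coeff g b \<noteq> 0})"
    (is "_ \<subseteq> ?R") for c
  proof safe
    fix e assume e: "e \<le> c"
      and "(\<Sum>a | coeff f a \<noteq> 0 \<and> coeff g (e - a) \<noteq> 0. coeff f a * coeff g (e - a)) \<noteq> 0"
    then obtain a where a: "coeff f a \<noteq> 0" "coeff g (e - a) \<noteq> 0"
      by (smt (verit) mem_Collect_eq sum.not_neutral_contains_not_neutral)
    have "m \<le> a" "n \<le> e - a" using a mn order_geD by (metis not_le)+
    then have "(a, e - a) \<in> {a. a \<le> c - n \<and> coeff f a \<noteq> 0} \<times> {b. b \<le> c - m \<and> coeff g b \<noteq> 0}"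
      using a e by auto
    then show "e \<in> ?R" by (intro image_eqI[of _ _ "(a, e - a)"]) auto
  qed
  moreover have "finite ((\<lambda>(a, b). a + b) `
      ({a. a \<le> c - n \<and> coeff f a \<noteq> 0} \<times> {b. b \<le> c - m \<and> coeff g b \<noteq> 0}))" for c
    by (intro finite_imageI finite_cartesian_product finite_coeff)
  ultimately show ?thesis unfolding times_aseries_def
    by (subst coeff_Abs_aseries) (blast intro: finite_subset)+
qed

text \<open>
  Products are evaluated over any finite index set that is large enough, since sums of several
  products, or of products of products, need a common one.
\<close>

lemma coeff_mult:
  fixes f g :: "'a aseries"
  assumes "finite J" "\<And>a. coeff f a \<noteq> 0 \<Longrightarrow> coeff g (e - a) \<noteq> 0 \<Longrightarrow> a \<in> J"
  shows "coeff (f * g) e = (\<Sum>a\<in>J. coeff f a * coeff g (e - a))"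
  unfolding coeff_mult' using assms by (intro sum.mono_neutral_left) auto

lemma coeff_mult_right:
  fixes f g :: "'a aseries"
  assumes "finite J" "\<And>b. coeff g b \<noteq> 0 \<Longrightarrow> coeff f (e - b) \<noteq> 0 \<Longrightarrow> b \<in> J"
  shows "coeff (f * g) e = (\<Sum>b\<in>J. coeff f (e - b) * coeff g b)"
proof -
  have "coeff (f * g) e = (\<Sum>a\<in>(\<lambda>b. e - b) ` J. coeff f a * coeff g (e - a))"
  proof (rule coeff_mult)
    fix a assume "coeff f a \<noteq> 0" "coeff g (e - a) \<noteq> 0"
    then show "a \<in> (\<lambda>b. e - b) ` J" using assms(2)[of "e - a"]
      by (intro image_eqI[of _ _ "e - a"]) auto
  qed (use assms in auto)
  also have "\<dots> = (\<Sum>b\<in>J. coeff f (e - b) * coeff g b)"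
    by (subst sum.reindex) (auto simp: inj_on_def)
  finally show ?thesis .
qed

instance
proof
  fix f g h :: "'a aseries"
  show comm: "f * g = g * f" for f g :: "'a aseries"
  proof (rule aseries_eqI)
    fix e
    show "coeff (f * g) e = coeff (g * f) e"
      by (subst coeff_mult_right[OF finite_mult_support[of g f e]])
         (auto simp: coeff_mult' mult.commute)
  qed
  show "f * g * h = f * (g * h)"
  proof (rule aseries_eqI)
    fix e
    obtain l m n where lmn: "order_ge l f" "order_ge m g" "order_ge n h" by (metis ex_order_ge)
    \<comment> \<open>Both bracketings are the sum over F times H, where F and H hold every exponent
      of f and of h that can contribute to exponent e.\<close>
    define F where "F = {a. a \<le> e - n - m \<and> coeff f a \<noteq> 0}"
    define H where "H = {a. a \<le> e - l - m \<and> coeff h a \<noteq> 0}"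
    have fin: "finite F" "finite H" by (auto simp: F_def H_def finite_coeff)
    have ge: "coeff f a \<noteq> 0 \<Longrightarrow> l \<le> a" "coeff g a \<noteq> 0 \<Longrightarrow> m \<le> a" "coeff h a \<noteq> 0 \<Longrightarrow> n \<le> a" for a
      using lmn order_geD by (metis not_le)+
    have fg: "coeff (f * g) a = 0" if "a < l + m" for a
      unfolding coeff_mult' using that ge by (intro sum.neutral) force
    have gh: "coeff (g * h) a = 0" if "a < m + n" for a
      unfolding coeff_mult' using that ge by (intro sum.neutral) force
    have "coeff (f * g * h) e = (\<Sum>c\<in>H. coeff (f * g) (e - c) * coeff h c)"
    proof (rule coeff_mult_right[OF fin(2)])
      fix b assume "coeff h b \<noteq> 0" "coeff (f * g) (e - b) \<noteq> 0"
      then show "b \<in> H" using fg[of "e - b"] by (force simp: H_def)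
    qed
    also have "\<dots> = (\<Sum>c\<in>H. \<Sum>a\<in>F. coeff f a * coeff g (e - c - a) * coeff h c)"
    proof (rule sum.cong[OF refl])
      fix c assume c: "c \<in> H"
      have "coeff (f * g) (e - c) = (\<Sum>a\<in>F. coeff f a * coeff g (e - c - a))"
      proof (rule coeff_mult[OF fin(1)])
        fix a assume "coeff f a \<noteq> 0" "coeff g (e - c - a) \<noteq> 0"
        then show "a \<in> F" using ge(2)[of "e - c - a"] ge(3)[of c] c by (auto simp: F_def H_def)
      qed
      then show "coeff (f * g) (e - c) * coeff h c
        = (\<Sum>a\<in>F. coeff f a * coeff g (e - c - a) * coeff h c)"
        by (simp add: sum_distrib_right)
    qed
    also have "\<dots> = (\<Sum>a\<in>F. \<Sum>c\<in>H. coeff f a * (coeff g (e - a - c) * coeff h c))"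
      by (subst sum.swap) (simp add: algebra_simps)
    also have "\<dots> = (\<Sum>a\<in>F. coeff f a * coeff (g * h) (e - a))"
    proof (rule sum.cong[OF refl])
      fix a assume a: "a \<in> F"
      have "coeff (g * h) (e - a) = (\<Sum>c\<in>H. coeff g (e - a - c) * coeff h c)"
      proof (rule coeff_mult_right[OF fin(2)])
        fix c assume "coeff h c \<noteq> 0" "coeff g (e - a - c) \<noteq> 0"
        then show "c \<in> H" using ge(2)[of "e - a - c"] ge(1)[of a] a by (auto simp: F_def H_def)
      qed
      then show "(\<Sum>c\<in>H. coeff f a * (coeff g (e - a - c) * coeff h c)) = coeff f a * coeff (g * h) (e - a)"
        by (simp add: sum_distrib_left)
    qed
    also have "\<dots> = coeff (f * (g * h)) e"
    proof (rule coeff_mult[OF fin(1), symmetric])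
      fix a assume "coeff f a \<noteq> 0" "coeff (g * h) (e - a) \<noteq> 0"
      then show "a \<in> F" using gh[of "e - a"] by (force simp: F_def)
    qed
    finally show "coeff (f * g * h) e = coeff (f * (g * h)) e" .
  qed
  show "1 * f = f"
  proof (rule aseries_eqI)
    fix e
    have "coeff (1 * f) e = (\<Sum>a\<in>{0}. coeff 1 a * coeff f (e - a))"
      by (rule coeff_mult) (auto simp: one_aseries_def split: if_splits)
    then show "coeff (1 * f) e = coeff f e" by (simp add: one_aseries_def)
  qed
  show "(f + g) * h = f * h + g * h"
  proof (rule aseries_eqI)
    fix e
    let ?J = "{a. coeff f a \<noteq> 0 \<and> coeff h (e - a) \<noteq> 0} \<union> {a. coeff g a \<noteq> 0 \<and> coeff h (e - a) \<noteq> 0}"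
    have fin: "finite ?J" by (simp add: finite_mult_support)
    show "coeff ((f + g) * h) e = coeff (f * h + g * h) e"
    proof -
      have "coeff ((f + g) * h) e = (\<Sum>a\<in>?J. coeff (f + g) a * coeff h (e - a))"
        by (rule coeff_mult[OF fin]) auto
      moreover have "coeff (f * h) e = (\<Sum>a\<in>?J. coeff f a * coeff h (e - a))"
        by (rule coeff_mult[OF fin]) auto
      moreover have "coeff (g * h) e = (\<Sum>a\<in>?J. coeff g a * coeff h (e - a))"
        by (rule coeff_mult[OF fin]) auto
      ultimately show ?thesis by (simp only: coeff_add distrib_right sum.distrib)
    qed
  qed
  have "coeff (0 :: 'a aseries) 0 \<noteq> coeff 1 0" by (simp add: one_aseries_def)
  then show "(0 :: 'a aseries) \<noteq> 1" by metis
qed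
end

instantiation aseries :: (real_comm_algebra_1) real_comm_algebra_1
begin
definition "scaleR r f = Abs_aseries (\<lambda>a. r *\<^sub>R coeff f a)"

lemma coeff_scaleR [simp]: "coeff (r *\<^sub>R f) a = r *\<^sub>R coeff f a"
  unfolding scaleR_aseries_def
  by (subst coeff_Abs_aseries) (auto intro: finite_subset[OF _ finite_coeff[of _ f]])

instance
proof
  fix r :: real and f g :: "'a aseries"
  show *: "r *\<^sub>R f * g = r *\<^sub>R (f * g)" for f g :: "'a aseries"
  proof (rule aseries_eqI)
    fix e
    show "coeff (r *\<^sub>R f * g) e = coeff (r *\<^sub>R (f * g)) e"
      by (subst coeff_mult[OF finite_mult_support[of f g e]])
         (auto simp: coeff_mult' scaleR_sum_right)
  qed
  show "f * r *\<^sub>R g = r *\<^sub>R (f * g)" using *[of g f] by (simp add: mult.commute)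
qed (auto intro!: aseries_eqI simp: algebra_simps)
end

lemma coeff_one: "coeff 1 a = (if a = 0 then 1 else 0)"
  by (simp add: one_aseries_def)

lemma coeff_monom_mult [simp]:
  fixes f :: "'k::comm_ring_1 aseries"
  shows "coeff (monom c a * f) e = c * coeff f (e - a)"
  by (subst coeff_mult[of "{a}"]) (auto split: if_splits)

lemma monom_mult_monom:
  "monom c a * monom d b = monom (c * d :: 'k::comm_ring_1) (a + b)"
  by (rule aseries_eqI) auto

lemma coeff_mult_leading:
  fixes f g :: "'k::comm_ring_1 aseries"
  assumes "order_ge m f" "order_ge n g"
  shows "order_ge (m + n) (f * g)" "coeff (f * g) (m + n) = coeff f m * coeff g n"
proof -
  have *: "{a. coeff f a \<noteq> 0 \<and> coeff g (e - a) \<noteq> 0} \<subseteq> (if e = m + n then {m} else {})"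
    if "e \<le> m + n" for e
    using that assms by (force simp: order_ge_def not_less[symmetric])
  show "order_ge (m + n) (f * g)"
    unfolding order_ge_def coeff_mult'
  proof (intro allI impI)
    fix e assume "e < m + n"
    then have "{a. coeff f a \<noteq> 0 \<and> coeff g (e - a) \<noteq> 0} = {}" using *[of e] by simp
    then show "(\<Sum>a | coeff f a \<noteq> 0 \<and> coeff g (e - a) \<noteq> 0. coeff f a * coeff g (e - a)) = 0"
      by (simp only: sum.empty)
  qed
  show "coeff (f * g) (m + n) = coeff f m * coeff g n"
    using * [of "m + n"] by (subst coeff_mult[of "{m}"]) auto
qed

lemma order_ge_mono: "order_ge m f \<Longrightarrow> n \<le> m \<Longrightarrow> order_ge n f"
  by (auto simp: order_ge_def)

lemma order_ge_monom: "order_ge a (monom c a)"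
  by (simp add: order_ge_def)

section \<open>The derivation x d/dx and continuous additive maps\<close>

definition theta :: "'k::real_comm_algebra_1 aseries \<Rightarrow> 'k aseries" where
  "theta f = Abs_aseries (\<lambda>a. a *\<^sub>R coeff f a)"

lemma coeff_theta [simp]: "coeff (theta f) a = a *\<^sub>R coeff f a"
  unfolding theta_def
  by (subst coeff_Abs_aseries) (auto intro: finite_subset[OF _ finite_coeff[of _ f]])

lemma theta_add: "theta (f + g) = theta f + theta g"
  by (rule aseries_eqI) (simp add: algebra_simps)

lemma theta_diff: "theta (f - g) = theta f - theta g"
  by (rule aseries_eqI) (simp add: algebra_simps)

lemma theta_zero [simp]: "theta 0 = 0"
  by (rule aseries_eqI) simp

lemma theta_one [simp]: "theta 1 = 0"
  by (rule aseries_eqI) (simp add: coeff_one)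

lemma theta_monom: "theta (monom c a) = a *\<^sub>R monom c a"
  by (rule aseries_eqI) auto

lemma theta_monom_0: "theta (monom c 0) = 0"
  by (simp add: theta_monom)

lemma theta_mult: "theta (f * g) = theta f * g + f * theta g"
proof (rule aseries_eqI)
  fix e
  let ?J = "{a. coeff f a \<noteq> 0 \<and> coeff g (e - a) \<noteq> 0}"
  have "coeff (theta f * g) e = (\<Sum>a\<in>?J. coeff (theta f) a * coeff g (e - a))"
    "coeff (f * theta g) e = (\<Sum>a\<in>?J. coeff f a * coeff (theta g) (e - a))"
    by (rule coeff_mult[OF finite_mult_support]; auto)+
  then have "coeff (theta f * g + f * theta g) e
      = (\<Sum>a\<in>?J. e *\<^sub>R (coeff f a * coeff g (e - a)))"
    by (simp flip: sum.distrib scaleR_add_left)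
  then show "coeff (theta (f * g)) e = coeff (theta f * g + f * theta g) e"
    by (simp add: coeff_mult' scaleR_sum_right)
qed

lemma order_ge_theta: "order_ge m f \<Longrightarrow> order_ge m (theta f)"
  by (simp add: order_ge_def)

text \<open>
  The kernel of the derivation consists of the constants. This is where real scalars, that is, characteristic
  zero, enter: a nonzero \<open>a\<close> can be cancelled in \<open>a c = 0\<close>.
\<close>

lemma theta_eq_zeroD: "theta f = 0 \<Longrightarrow> f = monom (coeff f 0) 0"
proof (rule aseries_eqI)
  fix a assume "theta f = 0"
  then have "a *\<^sub>R coeff f a = 0" by (metis coeff_theta coeff_zero)
  then show "coeff f a = coeff (monom (coeff f 0) 0) a" by auto
qed

text \<open>
  Finite sums of monomials are dense, so maps of this kind are determined by their values on monomials.
\<close>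

definition cts_additive :: "('k::ab_group_add aseries \<Rightarrow> 'l::ab_group_add aseries) \<Rightarrow> bool" where
  "cts_additive L \<longleftrightarrow> (\<forall>f g. L (f + g) = L f + L g) \<and>
     (\<forall>c. \<exists>m. \<forall>f. order_ge m f \<longrightarrow> order_ge c (L f))"

lemma cts_additive_coeff_ext:
  fixes L L' :: "'k::ab_group_add aseries \<Rightarrow> 'l::ab_group_add aseries"
  assumes L: "cts_additive L" "cts_additive L'"
    and eq: "\<And>c a. coeff (L (monom c a)) e = coeff (L' (monom c a)) e"
  shows "coeff (L f) e = coeff (L' f) e"
proof -
  define \<Delta> where "\<Delta> f = coeff (L f) e - coeff (L' f) e" for f
  have add: "\<Delta> (f + g) = \<Delta> f + \<Delta> g" for f g
    using L by (simp add: \<Delta>_def cts_additive_def)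
  have mon: "\<Delta> (monom c a) = 0" for c a by (simp add: \<Delta>_def eq)
  have sum: "\<Delta> (\<Sum>i\<in>I. monom (p i) (q i)) = 0" if "finite I" for I :: "real set" and p q
    using that
  proof induction
    case empty
    then show ?case using add[of 0 0] by simp
  qed (simp add: add mon)
  obtain m m' where m: "\<And>f. order_ge m f \<Longrightarrow> order_ge (e + 1) (L f)"
      "\<And>f. order_ge m' f \<Longrightarrow> order_ge (e + 1) (L' f)"
    using L unfolding cts_additive_def by meson
  \<comment> \<open>Beyond exponent M the series f influences neither of the two coefficients, and what
    remains of f is a finite sum of monomials.\<close>
  define M where "M = max m m'"
  define S where "S = {a. a \<le> M \<and> coeff f a \<noteq> 0}"
  define g where "g = (\<Sum>a\<in>S. monom (coeff f a) a)"
  have S: "finite S" by (simp add: S_def finite_coeff)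
  have "coeff (f - g) a = 0" if "a < M" for a
    using that S by (auto simp: g_def S_def if_distrib cong: if_cong)
  then have "order_ge M (f - g)" by (simp add: order_ge_def)
  then have "order_ge (e + 1) (L (f - g))" "order_ge (e + 1) (L' (f - g))"
    using m[of "f - g"] order_ge_mono[of M "f - g"] by (simp_all add: M_def)
  then have "\<Delta> (f - g) = 0" by (simp add: \<Delta>_def order_ge_def)
  then have "\<Delta> f = 0" using add[of "f - g" g] sum[OF S] by (simp add: g_def)
  then show ?thesis by (simp add: \<Delta>_def)
qed

lemma cts_additive_ext:
  assumes "cts_additive L" "cts_additive L'" "\<And>c a. L (monom c a) = L' (monom c a)"
  shows "L f = L' f"
  by (rule aseries_eqI, rule cts_additive_coeff_ext[OF assms(1,2)], simp only: assms(3))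

lemma cts_additive_id: "cts_additive (\<lambda>f. f)"
  by (auto simp: cts_additive_def)

lemma cts_additive_theta: "cts_additive theta"
  using order_ge_theta by (auto simp: cts_additive_def theta_add)

lemma cts_additive_comp:
  assumes "cts_additive L" "cts_additive L'"
  shows "cts_additive (\<lambda>f. L (L' f))"
  using assms unfolding cts_additive_def by metis

lemma cts_additive_mult:
  fixes g :: "'k::comm_ring_1 aseries"
  shows "cts_additive (\<lambda>f. g * f)"
proof -
  obtain n where n: "order_ge n g" by (rule ex_order_ge)
  have "order_ge c (g * f)" if "order_ge (c - n) f" for c f
    using coeff_mult_leading(1)[OF n that] by simp
  then show ?thesis by (auto simp: cts_additive_def algebra_simps)
qed

lemma cts_additive_mult_left: "cts_additive (\<lambda>f. f * g)" for g :: "'k::comm_ring_1 aseries"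
  using cts_additive_mult[of g] by (simp add: mult.commute)

section \<open>The binomial series\<close>

definition positive_order :: "'k::zero aseries \<Rightarrow> bool" where
  "positive_order u \<longleftrightarrow> (\<forall>a\<le>0. coeff u a = 0)"

text \<open>
  The multisets that contribute to the coefficient of \<open>x\<^sup>e\<close> in a power of \<open>1 + u\<close>. Since the support of
  \<open>u\<close> is positive and finite below any bound, there are finitely many of them for all exponents below
  any bound.
\<close>

definition exponent_msets :: "'k::zero aseries \<Rightarrow> real \<Rightarrow> real multiset set" where
  "exponent_msets u e = {M. (\<forall>j\<in>#M. coeff u j \<noteq> 0) \<and> \<Sum>\<^sub># M = e}"

lemma sum_mset_nonneg_real: "(\<And>x. x \<in># M \<Longrightarrow> 0 \<le> x) \<Longrightarrow> 0 \<le> \<Sum>\<^sub># M" for M :: "real multiset"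
  by (induction M) auto

lemma finite_exponent_msets_le:
  assumes "positive_order u"
  shows "finite {M. (\<forall>j\<in>#M. coeff u j \<noteq> 0) \<and> \<Sum>\<^sub># M \<le> c}"
proof -
  define S where "S = {a. a \<le> c \<and> coeff u a \<noteq> 0}"
  have S: "finite S" by (simp add: S_def finite_coeff)
  have pos: "0 < a" if "coeff u a \<noteq> 0" for a
    using assms that by (force simp: positive_order_def not_le[symmetric])
  \<comment> \<open>A positive lower bound for the exponents, which bounds the size of the multisets by
    c / \<mu>; the element 1 only serves to make the set nonempty.\<close>
  define \<mu> where "\<mu> = Min (insert 1 S)"
  have \<mu>: "\<mu> > 0" "\<And>a. a \<in> S \<Longrightarrow> \<mu> \<le> a"
    using S pos by (auto simp: \<mu>_def S_def)
  have "{M. (\<forall>j\<in>#M. coeff u j \<noteq> 0) \<and> \<Sum>\<^sub># M \<le> c}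
      \<subseteq> mset ` {xs. set xs \<subseteq> S \<and> length xs \<le> nat \<lfloor>c / \<mu>\<rfloor>}"
  proof
    fix M assume "M \<in> {M. (\<forall>j\<in>#M. coeff u j \<noteq> 0) \<and> \<Sum>\<^sub># M \<le> c}"
    then have M: "\<And>j. j \<in># M \<Longrightarrow> coeff u j \<noteq> 0" "\<Sum>\<^sub># M \<le> c" by auto
    have in_S: "j \<in> S" if j: "j \<in># M" for j
    proof -
      obtain N where N: "M = add_mset j N" using j by (blast dest: multi_member_split)
      have "\<And>x. x \<in># N \<Longrightarrow> 0 \<le> x" using M(1) pos N by force
      then have "0 \<le> \<Sum>\<^sub># N" by (rule sum_mset_nonneg_real)
      then show ?thesis using M j N by (simp add: S_def)
    qed
    have "real (size M) * \<mu> \<le> \<Sum>\<^sub># M"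
      using in_S
    proof (induction M)
      case (add x M)
      then show ?case using \<mu>(2)[of x] by (simp add: algebra_simps)
    qed simp
    then have "real (size M) \<le> c / \<mu>" using M(2) \<mu>(1) by (simp add: field_simps)
    then have "size M \<le> nat \<lfloor>c / \<mu>\<rfloor>" by (simp add: le_nat_floor)
    moreover obtain xs where "mset xs = M" by (metis ex_mset)
    ultimately show "M \<in> mset ` {xs. set xs \<subseteq> S \<and> length xs \<le> nat \<lfloor>c / \<mu>\<rfloor>}"
      using in_S by (intro image_eqI[of _ _ xs]) auto
  qed
  then show ?thesis
    using finite_lists_length_le[OF S] finite_subset by blast
qed

lemma finite_exponent_msets: "positive_order u \<Longrightarrow> finite (exponent_msets u e)"
  by (rule finite_subset[OF _ finite_exponent_msets_le[of u e]]) (auto simp: exponent_msets_def)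

text \<open>
  The additive monoid generated by the support of \<open>u\<close>. It contains the support of every power of \<open>1 + u\<close>,
  uniformly in the exponent of the power.
\<close>

definition exponent_monoid :: "'k::zero aseries \<Rightarrow> real set" where
  "exponent_monoid u = {e. exponent_msets u e \<noteq> {}}"

lemma finite_exponent_monoid:
  assumes "positive_order u"
  shows "finite (exponent_monoid u \<inter> {..c})"
proof -
  have "exponent_monoid u \<inter> {..c} \<subseteq> sum_mset ` {M. (\<forall>j\<in>#M. coeff u j \<noteq> 0) \<and> \<Sum>\<^sub># M \<le> c}"
    by (auto simp: exponent_monoid_def exponent_msets_def)
  then show ?thesis using finite_exponent_msets_le[OF assms] finite_subset by blast
qed

lemma exponent_msets_nonneg:
  assumes "positive_order u" "M \<in> exponent_msets u e"
  shows "0 \<le> e" "e = 0 \<Longrightarrow> M = {#}"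
proof -
  have pos: "0 < a" if "a \<in># M" for a
    using assms that by (force simp: positive_order_def exponent_msets_def not_le[symmetric])
  then have "0 \<le> \<Sum>\<^sub># N" if "N \<subseteq># M" for N
    using that by (intro sum_mset_nonneg_real) (meson less_imp_le mset_subset_eqD)
  moreover have "\<Sum>\<^sub># M = e" using assms by (simp add: exponent_msets_def)
  ultimately show "0 \<le> e" by blast
  show "M = {#}" if "e = 0"
  proof (rule ccontr)
    assume "M \<noteq> {#}"
    then obtain j N where N: "M = add_mset j N" by (metis multiset_cases)
    have "0 \<le> \<Sum>\<^sub># N" using \<open>\<And>N. N \<subseteq># M \<Longrightarrow> 0 \<le> \<Sum>\<^sub># N\<close> N by simp
    then show False using pos[of j] N \<open>\<Sum>\<^sub># M = e\<close> that by simp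
  qed
qed

text \<open>
  Weights other than \<open>mset_binomial t\<close> occur in the differential equation for the binomial series.
\<close>

definition mset_series ::
    "(real multiset \<Rightarrow> real) \<Rightarrow> 'k::real_comm_algebra_1 aseries \<Rightarrow> 'k aseries" where
  "mset_series w u =
     Abs_aseries (\<lambda>e. \<Sum>M\<in>exponent_msets u e. w M *\<^sub>R (\<Prod>j\<in>#M. coeff u j))"

lemma coeff_mset_series:
  assumes "positive_order u"
  shows "coeff (mset_series w u) e = (\<Sum>M\<in>exponent_msets u e. w M *\<^sub>R (\<Prod>j\<in>#M. coeff u j))"
  unfolding mset_series_def
proof (subst coeff_Abs_aseries)
  fix c
  have "{e. e \<le> c \<and> (\<Sum>M\<in>exponent_msets u e. w M *\<^sub>R (\<Prod>j\<in>#M. coeff u j)) \<noteq> 0}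
      \<subseteq> exponent_monoid u \<inter> {..c}"
    by (auto simp: exponent_monoid_def)
  then show "finite {e. e \<le> c \<and> (\<Sum>M\<in>exponent_msets u e. w M *\<^sub>R (\<Prod>j\<in>#M. coeff u j)) \<noteq> 0}"
    using finite_exponent_monoid[OF assms] finite_subset by blast
qed (rule refl)

lemma mset_series_support:
  assumes "positive_order u" "coeff (mset_series w u) e \<noteq> 0"
  shows "e \<in> exponent_monoid u"
  using assms by (auto simp: coeff_mset_series exponent_monoid_def)

lemma order_ge_mset_series: "positive_order u \<Longrightarrow> order_ge 0 (mset_series w u)"
  unfolding order_ge_def using mset_series_support exponent_msets_nonneg(1)
  by (fastforce simp: exponent_monoid_def)

lemma mset_binomial_empty [simp]: "mset_binomial t {#} = 1"
  by (simp add: mset_binomial_def)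

lemma exponent_msets_zero:
  "positive_order u \<Longrightarrow> exponent_msets u 0 = {{#}}"
  using exponent_msets_nonneg(2)[of u _ 0] by (auto simp: exponent_msets_def)

lemma coeff_mset_series_0: "positive_order u \<Longrightarrow> coeff (mset_series w u) 0 = of_real (w {#})"
  by (simp add: coeff_mset_series exponent_msets_zero of_real_def)

text \<open>
  The multiset form of \<open>(k + 1) binom(t, k + 1) = (t - k) binom(t, k)\<close>.
\<close>

lemma mset_binomial_add_mset:
  "real (count (add_mset j N) j) * mset_binomial t (add_mset j N)
     = (t - real (size N)) * mset_binomial t N"
proof -
  let ?S = "insert j (set_mset N)"
  have *: "(\<Prod>k\<in>set_mset N. fact (count N k)) = (\<Prod>k\<in>?S. fact (count N k) :: real)"
    by (rule prod.mono_neutral_left) (auto simp: not_in_iff)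
  also have "\<dots> = fact (count N j) * (\<Prod>k\<in>?S - {j}. fact (count N k))"
    by (rule prod.remove) auto
  finally have N: "(\<Prod>k\<in>set_mset N. fact (count N k) :: real)
      = fact (count N j) * (\<Prod>k\<in>?S - {j}. fact (count N k))" .
  have "(\<Prod>k\<in>set_mset (add_mset j N). fact (count (add_mset j N) k) :: real)
      = fact (Suc (count N j)) * (\<Prod>k\<in>?S - {j}. fact (count (add_mset j N) k))"
    unfolding set_mset_add_mset_insert by (subst prod.remove[of _ j]) auto
  also have "(\<Prod>k\<in>?S - {j}. fact (count (add_mset j N) k) :: real)
      = (\<Prod>k\<in>?S - {j}. fact (count N k))"
    by (rule prod.cong) auto
  finally have add: "(\<Prod>k\<in>set_mset (add_mset j N). fact (count (add_mset j N) k) :: real)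
      = real (Suc (count N j)) * (\<Prod>k\<in>set_mset N. fact (count N k))"
    unfolding N by (simp add: algebra_simps)
  have "(\<Prod>i<size (add_mset j N). t - real i) = (t - real (size N)) * (\<Prod>i<size N. t - real i)"
    by (simp add: mult.commute)
  then show ?thesis
    unfolding mset_binomial_def add by (simp del: of_nat_Suc)
qed

lemma sum_mset_image_count: "(\<Sum>j\<in>#M. \<phi> j) = (\<Sum>j\<in>set_mset M. real (count M j) * \<phi> j)"
proof (induction M)
  case (add x M)
  have "(\<Sum>j\<in>insert x (set_mset M). real (count (add_mset x M) j) * \<phi> j)
      = (\<Sum>j\<in>insert x (set_mset M). real (count M j) * \<phi> j)
        + (\<Sum>j\<in>insert x (set_mset M). if j = x then \<phi> x else 0)"
    by (subst sum.distrib[symmetric]) (auto intro!: sum.cong simp: algebra_simps)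
  also have "(\<Sum>j\<in>insert x (set_mset M). real (count M j) * \<phi> j)
      = (\<Sum>j\<in>set_mset M. real (count M j) * \<phi> j)"
    by (rule sum.mono_neutral_right) (auto simp: not_in_iff)
  finally show ?case using add by simp
qed simp

definition binomial_series :: "real \<Rightarrow> 'k::real_comm_algebra_1 aseries \<Rightarrow> 'k aseries" where
  "binomial_series t u = mset_series (mset_binomial t) u"

text \<open>
  Marking one element \<open>j\<close> of \<open>M\<close>, with weight \<open>\<phi> j\<close>, is the same as choosing the rest \<open>N\<close> and the marked
  element separately; \<open>mset_binomial_add_mset\<close> converts the weights. For \<open>\<phi> j = j\<close> the left-hand side is
  \<open>\<theta> ((1 + u)\<^sup>t)\<close>, and for \<open>\<phi> j = 1\<close> it weights each term by \<open>|M|\<close>; the comparison of the two gives the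
  differential equation.
\<close>

lemma mset_series_marked:
  fixes u v :: "'k::real_comm_algebra_1 aseries"
  assumes u: "positive_order u" and v: "\<And>j. coeff v j = \<phi> j *\<^sub>R coeff u j"
  shows "mset_series (\<lambda>M. (\<Sum>j\<in>#M. \<phi> j) * mset_binomial t M) u
    = mset_series (\<lambda>M. (t - real (size M)) * mset_binomial t M) u * v"
proof (rule aseries_eqI)
  fix e
  define J where "J = {j. j \<le> e \<and> coeff u j \<noteq> 0}"
  have J: "finite J" by (simp add: J_def finite_coeff)
  define c where "c M j = ((t - real (size M)) * mset_binomial t M * \<phi> j) *\<^sub>R
    ((\<Prod>j\<in>#M. coeff u j) * coeff u j)" for M j
  have "coeff (mset_series (\<lambda>M. (\<Sum>j\<in>#M. \<phi> j) * mset_binomial t M) u) e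
      = (\<Sum>M\<in>exponent_msets u e. \<Sum>j\<in>set_mset M. c (M - {#j#}) j)"
    unfolding coeff_mset_series[OF u]
  proof (rule sum.cong[OF refl])
    fix M
    have "(real (count M j) * \<phi> j * mset_binomial t M) *\<^sub>R (\<Prod>j\<in>#M. coeff u j) = c (M - {#j#}) j"
      if j: "j \<in># M" for j
    proof -
      obtain N where N: "M = add_mset j N" using j by (blast dest: multi_member_split)
      show ?thesis
        using mset_binomial_add_mset[of j N t] by (simp add: c_def N mult.commute mult.left_commute)
    qed
    then show "((\<Sum>j\<in>#M. \<phi> j) * mset_binomial t M) *\<^sub>R (\<Prod>j\<in>#M. coeff u j)
        = (\<Sum>j\<in>set_mset M. c (M - {#j#}) j)"
      by (simp add: sum_mset_image_count sum_distrib_right scaleR_sum_left)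
  qed
  also have "\<dots> = (\<Sum>(M, j)\<in>Sigma (exponent_msets u e) set_mset. c (M - {#j#}) j)"
    by (rule sum.Sigma) (auto simp: finite_exponent_msets[OF u])
  also have "\<dots> = (\<Sum>(j, N)\<in>Sigma J (\<lambda>j. exponent_msets u (e - j)). c N j)"
  proof (rule sum.reindex_bij_witness[of _ "\<lambda>(j, N). (add_mset j N, j)" "\<lambda>(M, j). (j, M - {#j#})"])
    fix p assume p: "p \<in> Sigma (exponent_msets u e) set_mset"
    obtain M j where Mj: "p = (M, j)" "M \<in> exponent_msets u e" "j \<in># M" using p by auto
    obtain N where N: "M = add_mset j N" using Mj by (blast dest: multi_member_split)
    have "N \<in> exponent_msets u (e - j)" using Mj by (auto simp: N exponent_msets_def)
    moreover from this have "j \<le> e" using exponent_msets_nonneg(1)[OF u] by fastforce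
    ultimately show "(case p of (M, j) \<Rightarrow> (j, M - {#j#})) \<in> Sigma J (\<lambda>j. exponent_msets u (e - j))"
      using Mj by (auto simp: N J_def exponent_msets_def)
  qed (auto simp: exponent_msets_def J_def)
  also have "\<dots> = (\<Sum>j\<in>J. \<Sum>N\<in>exponent_msets u (e - j). c N j)"
    by (rule sum.Sigma[symmetric]) (auto simp: finite_exponent_msets[OF u] J)
  also have "\<dots> = (\<Sum>j\<in>J. coeff (mset_series (\<lambda>M. (t - real (size M)) * mset_binomial t M) u) (e - j)
      * coeff v j)"
    unfolding coeff_mset_series[OF u] sum_distrib_right c_def v
    by (intro sum.cong refl) (simp add: mult_ac)
  also have "\<dots> = coeff (mset_series (\<lambda>M. (t - real (size M)) * mset_binomial t M) u * v) e"
  proof (rule coeff_mult_right[OF J, symmetric])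
    fix b assume "coeff v b \<noteq> 0"
      and "coeff (mset_series (\<lambda>M. (t - real (size M)) * mset_binomial t M) u) (e - b) \<noteq> 0"
    then show "b \<in> J"
      using order_geD[OF order_ge_mset_series[OF u], of "e - b"] by (force simp: J_def v)
  qed
  finally show "coeff (mset_series (\<lambda>M. (\<Sum>j\<in>#M. \<phi> j) * mset_binomial t M) u) e
    = coeff (mset_series (\<lambda>M. (t - real (size M)) * mset_binomial t M) u * v) e" .
qed

text \<open>
  Let \<open>P = (1 + u)\<^sup>t\<close>, let \<open>E\<close> be \<open>P\<close> with each term weighted by \<open>|M|\<close>, and \<open>W = t P - E\<close>. Marking an element
  gives \<open>\<theta> P = W \<theta> u\<close> and \<open>E = W u\<close>, so that \<open>(1 + u) W = t P\<close>.
\<close>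

lemma binomial_series_ode:
  assumes u: "positive_order u"
  shows "(1 + u) * theta (binomial_series t u) = t *\<^sub>R (binomial_series t u * theta u)"
proof -
  let ?P = "binomial_series t u"
  define W where "W = mset_series (\<lambda>M. (t - real (size M)) * mset_binomial t M) u"
  define E where "E = mset_series (\<lambda>M. (\<Sum>j\<in>#M. 1) * mset_binomial t M) u"
  have "theta ?P = mset_series (\<lambda>M. (\<Sum>j\<in>#M. j) * mset_binomial t M) u"
  proof (rule aseries_eqI)
    fix e
    show "coeff (theta ?P) e = coeff (mset_series (\<lambda>M. (\<Sum>j\<in>#M. j) * mset_binomial t M) u) e"
      unfolding coeff_theta binomial_series_def coeff_mset_series[OF u] scaleR_sum_right
      by (rule sum.cong) (auto simp: exponent_msets_def)
  qed
  then have D: "theta ?P = W * theta u"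
    unfolding W_def by (simp only:) (rule mset_series_marked[OF u], simp)
  have E: "E = W * u"
    unfolding W_def E_def by (rule mset_series_marked[OF u]) simp
  have "W = t *\<^sub>R ?P - E"
  proof (rule aseries_eqI)
    fix e
    show "coeff W e = coeff (t *\<^sub>R ?P - E) e"
      unfolding coeff_diff coeff_scaleR W_def E_def binomial_series_def coeff_mset_series[OF u]
        scaleR_sum_right sum_subtractf[symmetric]
      by (rule sum.cong) (auto simp: algebra_simps)
  qed
  then have "(1 + u) * W = t *\<^sub>R ?P" using E by (simp add: algebra_simps)
  then have "(1 + u) * (W * theta u) = t *\<^sub>R (?P * theta u)"
    by (metis mult.assoc mult_scaleR_left)
  then show ?thesis by (simp only: D)
qed

lemma coeff_binomial_series_0: "positive_order u \<Longrightarrow> coeff (binomial_series t u) 0 = 1"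
  by (simp add: binomial_series_def coeff_mset_series_0)

lemma order_ge_binomial_series: "positive_order u \<Longrightarrow> order_ge 0 (binomial_series t u)"
  by (simp add: binomial_series_def order_ge_mset_series)

lemma positive_order_minus_one:
  "order_ge 0 y \<Longrightarrow> coeff y 0 = 1 \<Longrightarrow> positive_order (y - 1)" for y :: "'k::real_comm_algebra_1 aseries"
  by (auto simp: positive_order_def order_ge_def coeff_one)

text \<open>
  If \<open>z\<close> had lowest exponent \<open>d\<close>, the coefficients of \<open>x\<^sup>d\<close> would give \<open>d z\<^sub>d = 0\<close>; but \<open>d \<noteq> 0\<close> as \<open>z\<close> has no constant
  term.
\<close>

lemma ode_zero_unique:
  fixes z u :: "'k::real_comm_algebra_1 aseries"
  assumes u: "positive_order u" and ode: "(1 + u) * theta z = t *\<^sub>R (z * theta u)"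
    and z0: "coeff z 0 = 0"
  shows "z = 0"
proof (rule ccontr)
  assume "z \<noteq> 0"
  then obtain d where d: "coeff z d \<noteq> 0" "order_ge d z" by (rule ex_leading)
  have 1: "order_ge 0 (1 + u)" "order_ge 0 (theta u)" "coeff (1 + u) 0 = 1" "coeff (theta u) 0 = 0"
    using u by (auto simp: positive_order_def order_ge_def coeff_one)
  have "coeff ((1 + u) * theta z) (0 + d) = d *\<^sub>R coeff z d"
    using coeff_mult_leading(2)[OF 1(1) order_ge_theta[OF d(2)]] 1 by simp
  moreover have "coeff (z * theta u) (d + 0) = 0"
    using coeff_mult_leading(2)[OF d(2) 1(2)] 1 by simp
  ultimately have "d *\<^sub>R coeff z d = 0" by (simp add: ode)
  then show False using d z0 by auto
qed

text \<open>
  All power laws below are instances: the candidate for a power satisfies the equation by the product rule.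
\<close>

lemma binomial_series_unique:
  assumes u: "positive_order u" and ode: "(1 + u) * theta y = t *\<^sub>R (y * theta u)"
    and y0: "coeff y 0 = 1"
  shows "y = binomial_series t u"
proof -
  have "(1 + u) * theta (y - binomial_series t u) = t *\<^sub>R ((y - binomial_series t u) * theta u)"
    using ode binomial_series_ode[OF u, of t]
    by (simp add: theta_diff right_diff_distrib left_diff_distrib scaleR_diff_right)
  then have "y - binomial_series t u = 0"
    by (rule ode_zero_unique[OF u]) (simp add: y0 coeff_binomial_series_0[OF u])
  then show ?thesis by simp
qed

lemma binomial_series_0: "positive_order u \<Longrightarrow> binomial_series 0 u = 1"
  by (rule binomial_series_unique[symmetric]) (auto simp: coeff_one)

lemma binomial_series_1: "positive_order u \<Longrightarrow> binomial_series 1 u = 1 + u"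
  by (rule binomial_series_unique[symmetric])
     (auto simp: coeff_one theta_add positive_order_def)

lemma binomial_series_add:
  assumes u: "positive_order u"
  shows "binomial_series (s + t) u = binomial_series s u * binomial_series t u" (is "_ = ?P * ?Q")
proof (rule binomial_series_unique[OF u, symmetric])
  have "(1 + u) * theta (?P * ?Q) = ((1 + u) * theta ?P) * ?Q + ?P * ((1 + u) * theta ?Q)"
    by (simp add: theta_mult algebra_simps)
  also have "\<dots> = (s + t) *\<^sub>R (?P * ?Q * theta u)"
    unfolding binomial_series_ode[OF u] by (simp add: algebra_simps)
  finally show "(1 + u) * theta (?P * ?Q) = (s + t) *\<^sub>R (?P * ?Q * theta u)" .
  show "coeff (?P * ?Q) 0 = 1"
    using coeff_mult_leading(2)[OF order_ge_binomial_series[OF u, of s] order_ge_binomial_series[OF u, of t]]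
    by (simp add: coeff_binomial_series_0[OF u])
qed

text \<open>
  The equation solved for the derivative: \<open>\<theta> (1 + u) / (1 + u)\<close> is written with the power \<open>-1\<close> as the inverse.
\<close>

lemma theta_binomial_series:
  assumes u: "positive_order u"
  shows "theta (binomial_series t u) = t *\<^sub>R (binomial_series t u * (binomial_series (-1) u * theta u))"
proof -
  have "binomial_series (-1) u * (1 + u) = 1"
    using binomial_series_add[OF u, of "-1" 1] by (simp add: binomial_series_0[OF u] binomial_series_1[OF u])
  then have "theta (binomial_series t u)
      = binomial_series (-1) u * ((1 + u) * theta (binomial_series t u))"
    by (simp flip: mult.assoc)
  also have "\<dots> = t *\<^sub>R (binomial_series t u * (binomial_series (-1) u * theta u))"
    unfolding binomial_series_ode[OF u] by (simp add: algebra_simps)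
  finally show ?thesis .
qed

text \<open>
  This is \<open>((1 + u)\<^sup>s)\<^sup>t = (1 + u)\<^sup>s\<^sup>t\<close>.
\<close>

lemma binomial_series_power:
  assumes u: "positive_order u"
  shows "binomial_series t (binomial_series s u - 1) = binomial_series (s * t) u"
proof (rule binomial_series_unique[symmetric])
  let ?v = "binomial_series s u - 1"
  show "positive_order ?v"
    using coeff_binomial_series_0[OF u, of s] order_ge_binomial_series[OF u, of s]
    by (intro positive_order_minus_one)
  have "theta ?v = theta (binomial_series s u)" by (simp add: theta_diff)
  then show "(1 + ?v) * theta (binomial_series (s * t) u) = t *\<^sub>R (binomial_series (s * t) u * theta ?v)"
    by (simp add: theta_binomial_series[OF u, of s] theta_binomial_series[OF u, of "s * t"] algebra_simps)
  show "coeff (binomial_series (s * t) u) 0 = 1" by (rule coeff_binomial_series_0[OF u])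
qed

section \<open>Substitution into a one-parameter group of powers\<close>

text \<open>
  If \<open>A a\<close> is the power \<open>f\<^sup>a\<close>, this is \<open>h(f)\<close>. Only the terms with \<open>a \<le> e\<close> are added up because \<open>A a\<close> will have
  order \<open>a\<close>.
\<close>

definition substitute ::
    "(real \<Rightarrow> 'k::real_comm_algebra_1 aseries) \<Rightarrow> 'k aseries \<Rightarrow> 'k aseries" where
  "substitute A h = Abs_aseries (\<lambda>e. \<Sum>a | a \<le> e \<and> coeff h a \<noteq> 0. coeff h a * coeff (A a) e)"

text \<open>
  The model is \<open>A a = f\<^sup>a\<close>, where \<open>f\<close> has degree one and positive real leading coefficient \<open>\<rho>\<close>; then \<open>logder\<close> is the
  logarithmic derivative \<open>\<theta> f / f\<close>. For a series \<open>f\<close> of degree \<open>-1\<close>, the reflection of a Noetherian delta series, it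
  is \<open>A a = f\<^sup>-\<^sup>a\<close>. The common support \<open>\<Gamma>\<close> of all the \<open>x\<^sup>-\<^sup>a A a\<close> is what makes the series inverse to a
  substitution well defined.
\<close>

locale power_group =
  fixes A :: "real \<Rightarrow> 'k::real_comm_algebra_1 aseries" and \<rho> :: real
    and logder :: "'k aseries" and \<Gamma> :: "real set"
  assumes base_pos: "\<rho> > 0"
    and A_add: "A (a + b) = A a * A b"
    and theta_A: "theta (A a) = a *\<^sub>R (A a * logder)"
    and order_ge_A: "order_ge a (A a)"
    and leading_A: "coeff (A a) a = of_real (\<rho> powr a)"
    and A_0: "A 0 = 1"
    and finite_shifts: "finite (\<Gamma> \<inter> {..c})"
    and A_support: "coeff (A a) e \<noteq> 0 \<Longrightarrow> e - a \<in> \<Gamma>"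
begin

lemma A_uminus: "A (- a) * A a = 1" "A a * A (- a) = 1"
  using A_add[of "-a" a] A_add[of a "-a"] A_0 by simp_all

lemma coeff_substitute:
  assumes "finite J" "\<And>a. a \<le> e \<Longrightarrow> coeff h a \<noteq> 0 \<Longrightarrow> a \<in> J"
  shows "coeff (substitute A h) e = (\<Sum>a\<in>J. coeff h a * coeff (A a) e)"
proof -
  have "{e. e \<le> c \<and> (\<Sum>a | a \<le> e \<and> coeff h a \<noteq> 0. coeff h a * coeff (A a) e) \<noteq> 0}
      \<subseteq> (\<Union>a\<in>{a. a \<le> c \<and> coeff h a \<noteq> 0}. {e. e \<le> c \<and> coeff (A a) e \<noteq> 0})" for c
  proof safe
    fix e assume e: "e \<le> c" "(\<Sum>a | a \<le> e \<and> coeff h a \<noteq> 0. coeff h a * coeff (A a) e) \<noteq> 0"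
    obtain a where "a \<in> {a. a \<le> e \<and> coeff h a \<noteq> 0}" "coeff h a * coeff (A a) e \<noteq> 0"
      using sum.not_neutral_contains_not_neutral[OF e(2)] by blast
    then show "e \<in> (\<Union>a\<in>{a. a \<le> c \<and> coeff h a \<noteq> 0}. {e. e \<le> c \<and> coeff (A a) e \<noteq> 0})"
      using e(1) by (intro UN_I[of a]) auto
  qed
  moreover have "finite (\<Union>a\<in>{a. a \<le> c \<and> coeff h a \<noteq> 0}. {e. e \<le> c \<and> coeff (A a) e \<noteq> 0})" for c
    by (intro finite_UN_I finite_coeff)
  ultimately have "coeff (substitute A h) e
      = (\<Sum>a | a \<le> e \<and> coeff h a \<noteq> 0. coeff h a * coeff (A a) e)"
    unfolding substitute_def by (subst coeff_Abs_aseries) (blast intro: finite_subset)+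
  also have "\<dots> = (\<Sum>a\<in>J. coeff h a * coeff (A a) e)"
  proof (rule sum.mono_neutral_left[OF assms(1)])
    show "\<forall>a\<in>J - {a. a \<le> e \<and> coeff h a \<noteq> 0}. coeff h a * coeff (A a) e = 0"
    proof
      fix a assume "a \<in> J - {a. a \<le> e \<and> coeff h a \<noteq> 0}"
      then show "coeff h a * coeff (A a) e = 0"
        using order_geD[OF order_ge_A[of a], of e] by auto
    qed
  qed (use assms(2) in auto)
  finally show ?thesis .
qed

lemma substitute_monom: "substitute A (monom c a) = monom c 0 * A a"
  by (rule aseries_eqI, subst coeff_substitute[of "{a}"]) (auto split: if_splits)

lemma substitute_add: "substitute A (f + g) = substitute A f + substitute A g"
proof (rule aseries_eqI)
  fix e
  let ?J = "{a. a \<le> e \<and> coeff f a \<noteq> 0} \<union> {a. a \<le> e \<and> coeff g a \<noteq> 0}"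
  have J: "finite ?J" by (simp add: finite_coeff)
  have "coeff (substitute A (f + g)) e = (\<Sum>a\<in>?J. coeff (f + g) a * coeff (A a) e)"
    by (rule coeff_substitute[OF J]) auto
  moreover have "coeff (substitute A f) e = (\<Sum>a\<in>?J. coeff f a * coeff (A a) e)"
    by (rule coeff_substitute[OF J]) auto
  moreover have "coeff (substitute A g) e = (\<Sum>a\<in>?J. coeff g a * coeff (A a) e)"
    by (rule coeff_substitute[OF J]) auto
  ultimately show "coeff (substitute A (f + g)) e = coeff (substitute A f + substitute A g) e"
    by (simp only: coeff_add distrib_right sum.distrib)
qed

lemma order_ge_substitute: "order_ge m h \<Longrightarrow> order_ge m (substitute A h)"
  unfolding order_ge_def
  by (auto simp: coeff_substitute[OF finite_coeff] intro!: sum.neutral)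

lemma cts_additive_substitute: "cts_additive (substitute A)"
  using order_ge_substitute by (auto simp: cts_additive_def substitute_add)

lemma leading_substitute:
  assumes "order_ge d h"
  shows "coeff (substitute A h) d = coeff h d * of_real (\<rho> powr d)"
proof -
  have "coeff (substitute A h) d = (\<Sum>a\<in>{d}. coeff h a * coeff (A a) d)"
    using order_geD[OF assms] by (intro coeff_substitute) force+
  then show ?thesis by (simp add: leading_A)
qed

lemma of_real_powr_cancel:
  assumes "c * of_real (\<rho> powr d) = (0::'k)"
  shows "c = 0"
proof -
  have "c * of_real (\<rho> powr d) * of_real (\<rho> powr (- d)) = 0" using assms by simp
  then have "c * of_real (\<rho> powr d * \<rho> powr (- d)) = 0"
    by (simp only: of_real_mult mult.assoc)
  moreover have "\<rho> powr d * \<rho> powr (- d) = 1"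
    using base_pos by (simp flip: powr_add)
  ultimately show ?thesis by simp
qed

lemma substitute_minus: "substitute A (f - g) = substitute A f - substitute A g"
  using substitute_add[of "f - g" g] by simp

text \<open>
  Substitution multiplies the lowest coefficient by a real power of \<open>\<rho>\<close>, which is invertible.
\<close>

lemma substitute_inject: "substitute A f = substitute A g \<Longrightarrow> f = g"
proof (rule ccontr)
  assume eq: "substitute A f = substitute A g" and "f \<noteq> g"
  then obtain d where d: "coeff (f - g) d \<noteq> 0" "order_ge d (f - g)"
    using ex_leading[of "f - g"] by auto
  have "coeff (f - g) d * of_real (\<rho> powr d) = 0"
    using leading_substitute[OF d(2)] eq by (simp add: substitute_minus)
  then show False using of_real_powr_cancel d(1) by blast
qed

lemma order_ge_substituteD:
  assumes "order_ge m (substitute A h)"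
  shows "order_ge m h"
proof (cases "h = 0")
  case True
  then show ?thesis by (simp add: order_ge_def)
next
  case False
  then obtain d where d: "coeff h d \<noteq> 0" "order_ge d h" by (rule ex_leading)
  have "coeff (substitute A h) d \<noteq> 0"
    using of_real_powr_cancel[of "coeff h d" d] d(1) leading_substitute[OF d(2)] by auto
  then have "m \<le> d" using order_geD[OF assms] by (meson not_le)
  then show ?thesis using d(2) order_ge_mono by blast
qed

lemma substitute_mult: "substitute A (f * g) = substitute A f * substitute A g"
proof -
  have mono: "substitute A (monom c a * g) = substitute A (monom c a) * substitute A g" for c a g
  proof (rule cts_additive_ext[of "\<lambda>g. substitute A (monom c a * g)"])
    show "cts_additive (\<lambda>g. substitute A (monom c a * g))"
      by (rule cts_additive_comp[OF cts_additive_substitute cts_additive_mult])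
    show "cts_additive (\<lambda>g. substitute A (monom c a) * substitute A g)"
      by (rule cts_additive_comp[OF cts_additive_mult cts_additive_substitute])
    show "substitute A (monom c a * monom d b) = substitute A (monom c a) * substitute A (monom d b)"
      for d b
    proof -
      have "monom (c * d) 0 = monom c 0 * monom d 0" by (simp add: monom_mult_monom)
      then show ?thesis by (simp add: monom_mult_monom substitute_monom A_add mult_ac)
    qed
  qed
  show ?thesis
  proof (rule cts_additive_ext[of "\<lambda>f. substitute A (f * g)"])
    show "cts_additive (\<lambda>f. substitute A (f * g))"
      by (rule cts_additive_comp[OF cts_additive_substitute cts_additive_mult_left])
    show "cts_additive (\<lambda>f. substitute A f * substitute A g)"
      by (rule cts_additive_comp[OF cts_additive_mult_left cts_additive_substitute])
  qed (rule mono)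
qed

text \<open>
  The chain rule.
\<close>

lemma theta_substitute: "theta (substitute A f) = substitute A (theta f) * logder"
proof (rule cts_additive_ext[of "\<lambda>f. theta (substitute A f)"])
  show "cts_additive (\<lambda>f. theta (substitute A f))"
    by (rule cts_additive_comp[OF cts_additive_theta cts_additive_substitute])
  show "cts_additive (\<lambda>f. substitute A (theta f) * logder)"
    by (rule cts_additive_comp[OF cts_additive_mult_left
          cts_additive_comp[OF cts_additive_substitute cts_additive_theta]])
  show "theta (substitute A (monom c a)) = substitute A (theta (monom c a)) * logder" for c a
  proof -
    have "theta (monom c a) = monom (a *\<^sub>R c) a"
      by (rule aseries_eqI) simp
    moreover have "monom (a *\<^sub>R c) 0 = a *\<^sub>R monom c 0"
      by (rule aseries_eqI) simp
    ultimately show ?thesis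
      by (simp add: substitute_monom theta_mult theta_monom_0 theta_A mult.assoc)
  qed
qed

lemma logder_eq: "logder = A (- 1) * theta (A 1)"
  using theta_A[of 1] A_uminus(1)[of 1] by (simp flip: mult.assoc)

lemma coeff_logder_0: "coeff logder 0 = 1"
proof -
  have "coeff logder (- 1 + 1) = of_real (\<rho> powr (- 1) * \<rho> powr 1)"
    unfolding logder_eq coeff_mult_leading(2)[OF order_ge_A[of "-1"] order_ge_theta[OF order_ge_A[of 1]]]
    by (simp only: leading_A coeff_theta of_real_mult scaleR_one)
  also have "\<rho> powr (- 1) * \<rho> powr 1 = 1" using base_pos by (simp flip: powr_add)
  finally show ?thesis by simp
qed

text \<open>
  Invariance of the residue under change of variable. On monomials of nonzero exponent both sides are residues of
  derivatives.
\<close>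

lemma residue_substitute: "coeff (substitute A h * logder) 0 = coeff h 0"
proof (rule cts_additive_coeff_ext[of "\<lambda>h. substitute A h * logder" "\<lambda>h. h"])
  show "cts_additive (\<lambda>h. substitute A h * logder)"
    by (rule cts_additive_comp[OF cts_additive_mult_left cts_additive_substitute])
  show "cts_additive (\<lambda>h::'k aseries. h)" by (rule cts_additive_id)
  show "coeff (substitute A (monom c a) * logder) 0 = coeff (monom c a) 0" for c a
  proof (cases "a = 0")
    case True
    then show ?thesis by (simp add: substitute_monom A_0 coeff_logder_0)
  next
    case False
    have "a *\<^sub>R coeff (A a * logder) 0 = coeff (theta (A a)) 0"
      by (simp add: theta_A)
    then have "coeff (A a * logder) 0 = 0" using False by simp
    then show ?thesis using False by (simp add: substitute_monom mult.assoc)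
  qed
qed

text \<open>
  The heart of Lagrange inversion: the coefficients of \<open>h\<close> are read off from \<open>h(f)\<close>.
\<close>

lemma lagrange_coeff: "a *\<^sub>R coeff h a = coeff (A (- a) * theta (substitute A h)) 0"
proof -
  have "a *\<^sub>R coeff h a = coeff (monom 1 (- a) * theta h) 0" by simp
  also have "\<dots> = coeff (substitute A (monom 1 (- a) * theta h) * logder) 0"
    by (rule residue_substitute[symmetric])
  also have "\<dots> = coeff (A (- a) * theta (substitute A h)) 0"
    by (simp add: substitute_mult substitute_monom theta_substitute mult.assoc flip: one_aseries_def)
  finally show ?thesis .
qed

lemma lagrange_inversion:
  assumes "substitute A h = monom 1 b"
  shows "a *\<^sub>R coeff h a = b *\<^sub>R coeff (A (- a)) (- b)"
proof -
  have "A (- a) * theta (monom 1 b) = b *\<^sub>R (monom 1 b * A (- a))"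
    by (simp add: theta_monom mult.commute)
  then show ?thesis unfolding lagrange_coeff assms by simp
qed

text \<open>
  If \<open>z\<close> has lowest exponent \<open>d\<close>, pairing it with \<open>A (- d)\<close> isolates its lowest coefficient.
\<close>

lemma residue_pairing_inject:
  assumes "\<And>a. coeff (A (- a) * z) 0 = 0"
  shows "z = 0"
proof (rule ccontr)
  assume "z \<noteq> 0"
  then obtain d where d: "coeff z d \<noteq> 0" "order_ge d z" by (rule ex_leading)
  have "coeff z d * of_real (\<rho> powr (- d)) = 0"
    using coeff_mult_leading(2)[OF order_ge_A[of "-d"] d(2)] assms[of d]
    by (simp add: leading_A mult.commute)
  then show False using of_real_powr_cancel d(1) by blast
qed

text \<open>
  \<open>lagrange_inversion\<close> dictates the coefficients of a solution. Conversely, let \<open>h\<close> have these coefficients. By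
  \<open>lagrange_coeff\<close>, \<open>\<theta> (h(f))\<close> and \<open>\<theta> (x\<^sup>b)\<close> have the same pairing with each \<open>f\<^sup>-\<^sup>a\<close>, so they are equal, and \<open>h(f)\<close> is
  \<open>x\<^sup>b\<close> up to a constant, which is subtracted from \<open>h\<close>.
\<close>

lemma ex_substitute_eq_monom:
  obtains h where "substitute A h = monom 1 b"
proof -
  \<comment> \<open>For a = 0 this is 0 by the convention b / 0 = 0; the constant term is corrected at the end.\<close>
  define c where "c a = (b / a) *\<^sub>R coeff (A (- a)) (- b)" for a
  have "finite {a. a \<le> m \<and> c a \<noteq> 0}" for m
  proof (rule finite_subset)
    show "{a. a \<le> m \<and> c a \<noteq> 0} \<subseteq> (\<lambda>e. e + b) ` (\<Gamma> \<inter> {..m - b})"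
    proof
      fix a assume "a \<in> {a. a \<le> m \<and> c a \<noteq> 0}"
      then have "a - b \<in> \<Gamma> \<inter> {..m - b}" using A_support[of "-a" "-b"] by (auto simp: c_def)
      then show "a \<in> (\<lambda>e. e + b) ` (\<Gamma> \<inter> {..m - b})"
        by (intro image_eqI[of _ _ "a - b"]) auto
    qed
  qed (simp add: finite_shifts)
  then have h: "coeff (Abs_aseries c) a = c a" for a by (simp add: coeff_Abs_aseries)
  let ?h = "Abs_aseries c"
  have "theta (substitute A ?h) - theta (monom 1 b) = 0"
  proof (rule residue_pairing_inject)
    fix a
    have "coeff (A (- a) * theta (substitute A ?h)) 0 = a *\<^sub>R c a"
      by (simp add: h flip: lagrange_coeff)
    also have "\<dots> = b *\<^sub>R coeff (A (- a)) (- b)"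
      by (cases "a = 0") (simp_all add: c_def A_0 coeff_one)
    also have "\<dots> = coeff (A (- a) * theta (monom 1 b)) 0"
      by (simp add: theta_monom mult.commute[of "A _"])
    finally show "coeff (A (- a) * (theta (substitute A ?h) - theta (monom 1 b))) 0 = 0"
      by (simp add: right_diff_distrib)
  qed
  then have "theta (substitute A ?h - monom 1 b) = 0" by (simp add: theta_diff)
  then obtain c0 where c0: "substitute A ?h - monom 1 b = monom c0 0"
    using theta_eq_zeroD by blast
  have "substitute A (?h - monom c0 0) = monom 1 b"
    using c0 by (simp add: substitute_minus substitute_monom A_0 algebra_simps)
  then show ?thesis by (rule that)
qed

end

text \<open>
  If \<open>F(f) = x\<close> then \<open>F\<^sup>b(f) = x\<^sup>b\<close>. Indeed, by the chain rule \<open>\<theta> (F\<^sup>b(f)) = b F\<^sup>b(f) \<kappa>\<close> with a factor \<open>\<kappa>\<close> that does not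
  depend on \<open>b\<close>, and \<open>b = s\<close> shows \<open>\<kappa> = 1\<close>. Hence \<open>F\<^sup>b(f)\<close> is a multiple of \<open>x\<^sup>b\<close>, and the leading coefficients agree.
\<close>

lemma substitute_inverse_powers:
  assumes "power_group A \<rho> logder \<Gamma>" "power_group B \<sigma> mu \<Delta>"
    and s: "s \<noteq> 0" and inv: "substitute A (B s) = monom 1 s" and lead: "\<sigma> * \<rho> = 1"
  shows "substitute A (B b) = monom 1 b"
proof -
  interpret A: power_group A \<rho> logder \<Gamma> by fact
  interpret B: power_group B \<sigma> mu \<Delta> by fact
  let ?k = "substitute A mu * logder"
  have th: "theta (substitute A (B b)) = b *\<^sub>R (substitute A (B b) * ?k)" for b
  proof -
    have sc: "substitute A (r *\<^sub>R f) = r *\<^sub>R substitute A f" for r f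
    proof -
      have *: "r *\<^sub>R f = monom (of_real r) 0 * f" for f :: "'a aseries"
        by (rule aseries_eqI) (simp add: of_real_def)
      show ?thesis unfolding * A.substitute_mult A.substitute_monom A.A_0 by simp
    qed
    show ?thesis unfolding A.theta_substitute B.theta_A sc A.substitute_mult by (simp add: mult.assoc)
  qed
  have "s *\<^sub>R monom 1 s = s *\<^sub>R (monom 1 s * ?k)"
    using th[of s] by (simp add: inv theta_monom)
  then have "monom 1 s = monom 1 s * ?k" using s by simp
  then have "monom 1 (- s) * monom 1 s = monom 1 (- s) * (monom 1 s * ?k)" by simp
  then have k: "?k = 1"
    by (simp add: monom_mult_monom flip: mult.assoc one_aseries_def)
  have "theta (monom 1 (- b) * substitute A (B b)) = 0"
    by (simp add: theta_mult theta_monom th k)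
  then obtain c where c: "monom 1 (- b) * substitute A (B b) = monom c 0"
    using theta_eq_zeroD by blast
  have "c = coeff (monom 1 (- b) * substitute A (B b)) 0" by (simp add: c)
  also have "\<dots> = of_real (\<sigma> powr b * \<rho> powr b)"
    by (simp add: A.leading_substitute[OF B.order_ge_A] B.leading_A)
  also have "\<sigma> powr b * \<rho> powr b = 1"
    using A.base_pos B.base_pos lead by (simp flip: powr_mult)
  finally have "monom 1 (- b) * substitute A (B b) = 1" using c by (simp flip: one_aseries_def)
  then have "monom 1 b * (monom 1 (- b) * substitute A (B b)) = monom 1 b" by simp
  then show ?thesis by (simp add: monom_mult_monom flip: mult.assoc one_aseries_def)
qed

text \<open>
  The first substitution is inverse to the second on monomials, hence everywhere. That it is inverse on the other side
  as well follows from its injectivity.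
\<close>

lemma substitute_inverse:
  assumes A: "power_group A \<rho> logder \<Gamma>" and B: "power_group B \<sigma> mu \<Delta>"
    and inv: "\<And>b. substitute A (B b) = monom 1 b"
  shows "substitute A (substitute B h) = h" "substitute B (substitute A h) = h"
proof -
  interpret A: power_group A \<rho> logder \<Gamma> by fact
  interpret B: power_group B \<sigma> mu \<Delta> by fact
  show *: "substitute A (substitute B h) = h" for h
  proof (rule cts_additive_ext[of "\<lambda>h. substitute A (substitute B h)"])
    show "cts_additive (\<lambda>h. substitute A (substitute B h))"
      by (rule cts_additive_comp[OF A.cts_additive_substitute B.cts_additive_substitute])
    show "cts_additive (\<lambda>h::'a aseries. h)" by (rule cts_additive_id)
    show "substitute A (substitute B (monom c a)) = monom c a" for c a
      by (simp add: B.substitute_monom A.substitute_mult A.substitute_monom A.A_0 inv monom_mult_monom)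
  qed
  show "substitute B (substitute A h) = h"
    by (rule A.substitute_inject) (rule *)
qed

section \<open>Real powers of a single series\<close>

text \<open>
  The power with exponent \<open>t\<close> of \<open>r x\<^sup>d (1 + u)\<close>.
\<close>

definition powers :: "real \<Rightarrow> real \<Rightarrow> 'k::real_comm_algebra_1 aseries \<Rightarrow> real \<Rightarrow> 'k aseries" where
  "powers d r u t = monom (of_real (r powr t)) (d * t) * binomial_series t u"

lemma powers_1: "r > 0 \<Longrightarrow> positive_order u \<Longrightarrow> powers d r u 1 = monom (of_real r) d * (1 + u)"
  by (simp add: powers_def binomial_series_1)

lemma powers_add:
  "positive_order u \<Longrightarrow> powers d r u (s + t) = powers d r u s * powers d r u t"
  by (simp add: powers_def binomial_series_add powr_add distrib_left mult_ac flip: monom_mult_monom)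

text \<open>
  The cases \<open>s = 1\<close> and \<open>s = -1\<close> belong to Artinian and Noetherian delta series; \<open>r powr s\<close> is the leading coefficient
  of the member of degree one.
\<close>

lemma power_group_powers:
  fixes u :: "'k::real_comm_algebra_1 aseries"
  assumes r: "r > 0" and u: "positive_order u" and s: "s * s = 1"
  shows "power_group (\<lambda>a. powers s r u (s * a)) (r powr s)
    (1 + s *\<^sub>R (binomial_series (- 1) u * theta u)) (exponent_monoid u)"
proof
  have ss: "s * (s * a) = a" for a using s by (simp flip: mult.assoc)
  show "r powr s > 0" using r by simp
  show "powers s r u (s * (a + b)) = powers s r u (s * a) * powers s r u (s * b)" for a b
    by (simp add: distrib_left powers_add[OF u])
  show "theta (powers s r u (s * a)) = a *\<^sub>R (powers s r u (s * a)
      * (1 + s *\<^sub>R (binomial_series (- 1) u * theta u)))" for a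
    by (simp add: powers_def theta_mult theta_monom theta_binomial_series[OF u] ss s algebra_simps)
  have co: "coeff (powers s r u (s * a)) e = of_real (r powr (s * a)) * coeff (binomial_series (s * a) u) (e - a)"
    for a e by (simp add: powers_def ss)
  show "order_ge a (powers s r u (s * a))" for a
    using order_geD[OF order_ge_binomial_series[OF u]] by (auto simp: order_ge_def co)
  show "coeff (powers s r u (s * a)) a = of_real ((r powr s) powr a)" for a
    by (simp add: co coeff_binomial_series_0[OF u] powr_powr)
  show "powers s r u (s * 0) = 1"
    using r by (simp add: powers_def binomial_series_0[OF u] flip: one_aseries_def)
  show "finite (exponent_monoid u \<inter> {..c})" for c
    by (rule finite_exponent_monoid[OF u])
  show "e - a \<in> exponent_monoid u" if "coeff (powers s r u (s * a)) e \<noteq> 0" for a e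
  proof (rule mset_series_support[OF u])
    show "coeff (mset_series (mset_binomial (s * a)) u) (e - a) \<noteq> 0"
      using that by (auto simp: co binomial_series_def)
  qed
qed

section \<open>Coefficient rings\<close>

text \<open>
  What the argument uses of the coefficients, in a form that passes from \<open>K\<close> to the series over \<open>K\<close>. The elements that
  are inverted or raised to real powers are positive real constants.
\<close>

locale coefficient_ring = cring R for R :: "('k, 'm) power_ring_scheme" (structure) +
  assumes one_neq_zero: "\<one> \<noteq> \<zero>"
    and const_closed [simp]: "const R z \<in> carrier R"
    and const_one [simp]: "const R 1 = \<one>"
    and const_add: "const R (z + w) = const R z \<oplus> const R w"
    and const_mult: "const R (z * w) = const R z \<otimes> const R w"
    and gpow_const: "r > 0 \<Longrightarrow> gpow R (const R (of_real r)) t 0 = const R (of_real (r powr t))"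
begin

lemma const_inverse: "r \<noteq> 0 \<Longrightarrow> const R (of_real r) \<otimes> const R (of_real (1 / r)) = \<one>"
  by (simp flip: const_mult of_real_mult)

lemma const_of_real_neq_zero: "r \<noteq> 0 \<Longrightarrow> const R (of_real r) \<noteq> \<zero>"
  using const_inverse[of r] one_neq_zero by auto

lemma inv_const: "r \<noteq> 0 \<Longrightarrow> inv (const R (of_real r)) = const R (of_real (1 / r))"
  using const_inverse[of r] by (intro comm_inv_char) auto

end

lemma coefficient_ring_complex: "coefficient_ring complex_field"
proof -
  have "cring complex_field"
  proof (rule cringI)
    show "abelian_group complex_field"
      by (rule abelian_groupI) (auto simp: complex_field_def intro: exI[of _ "- _"] left_minus)
    show "comm_monoid complex_field"
      by (rule comm_monoidI) (auto simp: complex_field_def)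
  qed (auto simp: complex_field_def algebra_simps)
  then show ?thesis
    unfolding coefficient_ring_def coefficient_ring_axioms_def
    by (auto simp: complex_field_def cpow_def Arg2pi_of_real)
qed

lemma coefficient_ring_transport:
  assumes "coefficient_ring R" and inv: "\<And>x. h' (h x) = x"
  shows "coefficient_ring (transport h h' R)"
proof -
  interpret coefficient_ring R by fact
  have "cring (transport h h' R)"
  proof (rule cringI)
    show "abelian_group (transport h h' R)"
    proof (rule abelian_groupI)
      fix x assume "x \<in> carrier (transport h h' R)"
      then obtain y where "x = h y" "y \<in> carrier R" by (auto simp: transport_def)
      then show "\<exists>y\<in>carrier (transport h h' R). y \<oplus>\<^bsub>transport h h' R\<^esub> x = \<zero>\<^bsub>transport h h' R\<^esub>"
        by (intro bexI[of _ "h (\<ominus>\<^bsub>R\<^esub> y)"]) (auto simp: transport_def inv l_neg)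
    qed (auto simp: transport_def inv a_ac)
    show "comm_monoid (transport h h' R)"
      by (rule comm_monoidI) (auto simp: transport_def inv m_ac)
  qed (auto simp: transport_def inv l_distr)
  then show ?thesis
    unfolding coefficient_ring_def coefficient_ring_axioms_def
    by (auto simp: transport_def inv const_add const_mult gpow_const)
       (metis inv one_neq_zero)
qed

text \<open>
  The product of all coefficient rings inside \<open>nested\<close>. Being a type, it supports type-class algebra, and each
  coefficient ring is its quotient under a projection \<open>\<lambda>x. component x K\<close>. The value \<open>undefined\<close> at the remaining indices
  makes elements equal as soon as their components agree.
\<close>

typedef ring_product = "{x :: nested power_ring \<Rightarrow> nested.
    \<forall>R. if coefficient_ring R then x R \<in> carrier R else x R = undefined}"
  morphisms component Abs_ring_product
proof
  show "(\<lambda>R. if coefficient_ring R then \<zero>\<^bsub>R\<^esub> else undefined) \<in> {x :: nested power_ring \<Rightarrow> nested.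
    \<forall>R. if coefficient_ring R then x R \<in> carrier R else x R = undefined}"
    by (auto dest: coefficient_ring.axioms(1) simp: cring_def abelian_group_def abelian_monoid.zero_closed ring_def)
qed

definition family :: "(nested power_ring \<Rightarrow> nested) \<Rightarrow> ring_product" where
  "family F = Abs_ring_product (\<lambda>R. if coefficient_ring R then F R else undefined)"

lemma component_family:
  assumes "\<And>R. coefficient_ring R \<Longrightarrow> F R \<in> carrier R" "coefficient_ring R"
  shows "component (family F) R = F R"
  using assms unfolding family_def by (subst Abs_ring_product_inverse) auto

lemma component_closed: "coefficient_ring R \<Longrightarrow> component x R \<in> carrier R"
  using component[of x] by (auto split: if_splits)

lemma ring_product_eqI:
  assumes "\<And>R. coefficient_ring R \<Longrightarrow> component x R = component y R"
  shows "x = y"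
proof -
  have "component x R = component y R" for R
    using assms component[of x] component[of y] by (cases "coefficient_ring R") auto
  then show ?thesis by (metis component_inverse ext)
qed

lemma coefficient_ring_algebra:
  assumes "coefficient_ring R"
  shows "cring R" "const R z \<in> carrier R"
  using assms by (auto simp: coefficient_ring_def coefficient_ring_axioms_def)

instantiation ring_product :: real_comm_algebra_1
begin
definition "0 = family (\<lambda>R. \<zero>\<^bsub>R\<^esub>)"
definition "1 = family (\<lambda>R. \<one>\<^bsub>R\<^esub>)"
definition "x + y = family (\<lambda>R. component x R \<oplus>\<^bsub>R\<^esub> component y R)"
definition "- x = family (\<lambda>R. \<ominus>\<^bsub>R\<^esub> component x R)"
definition "x - y = family (\<lambda>R. component x R \<ominus>\<^bsub>R\<^esub> component y R)"
definition "x * y = family (\<lambda>R. component x R \<otimes>\<^bsub>R\<^esub> component y R)"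
definition "c *\<^sub>R x = family (\<lambda>R. const R (of_real c) \<otimes>\<^bsub>R\<^esub> component x R)"

lemma component_ops:
  assumes "coefficient_ring R"
  shows "component 0 R = \<zero>\<^bsub>R\<^esub>" "component 1 R = \<one>\<^bsub>R\<^esub>"
    "component (x + y) R = component x R \<oplus>\<^bsub>R\<^esub> component y R"
    "component (- x) R = \<ominus>\<^bsub>R\<^esub> component x R"
    "component (x - y) R = component x R \<ominus>\<^bsub>R\<^esub> component y R"
    "component (x * y) R = component x R \<otimes>\<^bsub>R\<^esub> component y R"
    "component (c *\<^sub>R x) R = const R (of_real c) \<otimes>\<^bsub>R\<^esub> component x R"
  unfolding zero_ring_product_def one_ring_product_def plus_ring_product_def
    uminus_ring_product_def minus_ring_product_def times_ring_product_def scaleR_ring_product_def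
  using assms
  by (subst component_family;
      auto simp: component_closed coefficient_ring_algebra cring.cring_simprules)+

instance
proof
  fix x y z :: ring_product and a b :: real
  note defs = component_ops component_closed coefficient_ring.const_add coefficient_ring.const_mult
    coefficient_ring_algebra coefficient_ring.const_one
  show "x + y + z = x + (y + z)" "x + y = y + x" "0 + x = x" "- x + x = 0" "x - y = x + - y"
    "x * y * z = x * (y * z)" "x * y = y * x" "1 * x = x" "(x + y) * z = x * z + y * z"
    by (rule ring_product_eqI; simp add: defs cring.cring_simprules)+
  show "a *\<^sub>R (x + y) = a *\<^sub>R x + a *\<^sub>R y" "(a + b) *\<^sub>R x = a *\<^sub>R x + b *\<^sub>R x"
    "a *\<^sub>R b *\<^sub>R x = (a * b) *\<^sub>R x" "1 *\<^sub>R x = x"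
    "a *\<^sub>R x * y = a *\<^sub>R (x * y)" "x * a *\<^sub>R y = a *\<^sub>R (x * y)"
    by (rule ring_product_eqI; simp add: defs cring.cring_simprules)+
  show "x * (y + z) = x * y + x * z" "x * 1 = x"
    by (rule ring_product_eqI; simp add: defs cring.cring_simprules)+
  \<comment> \<open>Some coefficient ring must exist for the product to be nontrivial.\<close>
  have "coefficient_ring (coeff_field [])"
    by (simp add: coefficient_ring_transport coefficient_ring_complex)
  then show "0 \<noteq> (1 :: ring_product)"
    by (metis component_ops(1,2) coefficient_ring.one_neq_zero)
qed
end

lemma ex_component:
  assumes "coefficient_ring K" "x \<in> carrier K"
  obtains y where "component y K = x"
proof
  show "component (family (\<lambda>R. if R = K then x else \<zero>\<^bsub>R\<^esub>)) K = x"
    by (subst component_family)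
       (auto simp: assms coefficient_ring_algebra cring.cring_simprules)
qed

context
  fixes K :: "nested power_ring"
  assumes K: "coefficient_ring K"
begin

interpretation coefficient_ring K by (rule K)

lemmas component_simps [simp] = component_ops[OF K]

lemma component_in_carrier [simp]: "component x K \<in> carrier K"
  by (rule component_closed[OF K])

lemma component_of_real [simp]: "component (of_real c) K = const K (of_real c)"
  by (simp add: of_real_def)

lemma component_power: "component (x ^ n) K = component x K [^]\<^bsub>K\<^esub> n"
  by (induction n) (simp_all add: m_comm)

lemma component_sum: "component (sum g I) K = finsum K (\<lambda>i. component (g i) K) I" if "finite I"
  using that by (induction I) (auto simp: Pi_def)

lemma component_prod: "component (prod g I) K = finprod K (\<lambda>i. component (g i) K) I" if "finite I"
  using that by (induction I) (auto simp: Pi_def)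

text \<open>
  Every formal sum over \<open>K\<close> below is evaluated by this rule, which leaves an ordinary finite sum in the
  product ring.
\<close>

lemma fsum_component:
  assumes "finite J" "J \<subseteq> I" "\<And>i. i \<in> J \<Longrightarrow> h i = component (g i) K"
    "\<And>i. i \<in> I \<Longrightarrow> i \<notin> J \<Longrightarrow> h i = \<zero>\<^bsub>K\<^esub>"
  shows "fsum K h I = component (sum g J) K"
  unfolding fsum_def component_sum[OF assms(1)]
proof (rule add.finprod_mono_neutral_cong_left[OF assms(1)])
  show "{i \<in> I. h i \<noteq> \<zero>\<^bsub>K\<^esub>} \<subseteq> J" using assms(4) by blast
  show "component (g i) K = \<zero>\<^bsub>K\<^esub>" if "i \<in> J - {i \<in> I. h i \<noteq> \<zero>\<^bsub>K\<^esub>}" for i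
    using that assms(2,3) by force
  show "h i = component (g i) K" if "i \<in> {i \<in> I. h i \<noteq> \<zero>\<^bsub>K\<^esub>}" for i
    using that assms(3,4) by blast
qed auto

end

text \<open>
  The sign by which exponents are multiplied in order to turn series of either kind into Artinian ones.
\<close>

definition orientation :: "kind \<Rightarrow> real" where
  "orientation k = (case k of Artinian \<Rightarrow> 1 | Noetherian \<Rightarrow> - 1)"

lemma orientation_square [simp]:
  "orientation k * orientation k = 1" "orientation k * (orientation k * a) = a"
  by (cases k; simp add: orientation_def)+

lemma orientation_neq_0 [simp]: "orientation k \<noteq> 0"
  by (cases k; simp add: orientation_def)

lemma orientation_le:
  "(case k of Artinian \<Rightarrow> b \<le> a | Noetherian \<Rightarrow> b \<ge> a) \<longleftrightarrow> orientation k * b \<le> orientation k * a"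
  by (cases k) (simp_all add: orientation_def)

definition series_of :: "kind \<Rightarrow> nested power_ring \<Rightarrow> ring_product aseries \<Rightarrow> real \<Rightarrow> nested" where
  "series_of k K h = (\<lambda>a. component (coeff h (orientation k * a)) K)"

lemma mset_binomial_image_inj:
  assumes "inj \<phi>"
  shows "mset_binomial t (image_mset \<phi> M) = mset_binomial t M"
proof -
  have "count (image_mset \<phi> M) (\<phi> j) = count M j" for j
    by (induction M) (auto simp: inj_eq[OF assms])
  moreover have "inj_on \<phi> (set_mset M)" using assms by (rule inj_on_subset) simp
  ultimately show ?thesis
    by (simp add: mset_binomial_def prod.reindex)
qed

context
  fixes K :: "nested power_ring" and k :: kind
  assumes K: "coefficient_ring K"
begin

interpretation coefficient_ring K by (rule K)

private abbreviation "s \<equiv> orientation k"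

lemmas comp_simps [simp] = component_simps[OF K] component_in_carrier[OF K] component_of_real[OF K]

lemma series_of_closed: "series_of k K h \<in> series_set k K"
proof -
  have "finite {b. (case k of Artinian \<Rightarrow> b \<le> a | Noetherian \<Rightarrow> b \<ge> a) \<and> series_of k K h b \<noteq> \<zero>\<^bsub>K\<^esub>}" for a
  proof (rule finite_subset)
    show "{b. (case k of Artinian \<Rightarrow> b \<le> a | Noetherian \<Rightarrow> b \<ge> a) \<and> series_of k K h b \<noteq> \<zero>\<^bsub>K\<^esub>}
        \<subseteq> (\<lambda>b. s * b) ` {b. b \<le> s * a \<and> coeff h b \<noteq> 0}"
      unfolding orientation_le
    proof safe
      fix b assume "s * b \<le> s * a" "series_of k K h b \<noteq> \<zero>\<^bsub>K\<^esub>"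
      then show "b \<in> (\<lambda>b. s * b) ` {b. b \<le> s * a \<and> coeff h b \<noteq> 0}"
        by (intro image_eqI[of _ _ "s * b"]) (auto simp: series_of_def)
    qed
    show "finite ((\<lambda>b. s * b) ` {b. b \<le> s * a \<and> coeff h b \<noteq> 0})"
      by (intro finite_imageI finite_coeff)
  qed
  then show ?thesis by (simp add: series_set_def series_of_def)
qed

text \<open>
  Lifting a series to the product ring. The lift can be chosen with the same support, and such that a prescribed real
  coefficient \<open>r\<close> is lifted to the real number \<open>r\<close>, which is invertible in every component.
\<close>

lemma ex_series_of:
  assumes f: "f \<in> series_set k K"
  obtains h where "series_of k K h = f" "\<And>a. f a = \<zero>\<^bsub>K\<^esub> \<Longrightarrow> coeff h (s * a) = 0"
    "f d = const K (of_real r) \<Longrightarrow> r \<noteq> 0 \<Longrightarrow> coeff h (s * d) = of_real r"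
proof -
  have "\<exists>y. component y K = f a \<and> (f a = \<zero>\<^bsub>K\<^esub> \<longrightarrow> y = 0) \<and>
      (f a = const K (of_real r) \<longrightarrow> r \<noteq> 0 \<longrightarrow> y = of_real r)" for a
  proof (cases "f a = const K (of_real r) \<and> r \<noteq> 0")
    case True
    then show ?thesis
      using const_of_real_neq_zero by (intro exI[of _ "of_real r :: ring_product"]) auto
  next
    case no: False
    have "f a \<in> carrier K" using f by (simp add: series_set_def)
    then obtain y where "component y K = f a" by (rule ex_component[OF K])
    then show ?thesis
      using no by (cases "f a = \<zero>\<^bsub>K\<^esub>") (auto intro: exI[of _ "0 :: ring_product"])
  qed
  then obtain y where y: "\<And>a. component (y a) K = f a" "\<And>a. f a = \<zero>\<^bsub>K\<^esub> \<Longrightarrow> y a = 0"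
    "\<And>a. f a = const K (of_real r) \<Longrightarrow> r \<noteq> 0 \<Longrightarrow> y a = of_real r"
    by metis
  have "finite {a. a \<le> c \<and> y (s * a) \<noteq> 0}" for c
  proof (rule finite_subset)
    show "{a. a \<le> c \<and> y (s * a) \<noteq> 0} \<subseteq> (\<lambda>b. s * b) `
        {b. (case k of Artinian \<Rightarrow> b \<le> s * c | Noetherian \<Rightarrow> b \<ge> s * c) \<and> f b \<noteq> \<zero>\<^bsub>K\<^esub>}"
      unfolding orientation_le using y(2) by (auto intro!: image_eqI[of _ _ "s * _"])
  qed (use f in \<open>simp add: series_set_def\<close>)
  then have h: "coeff (Abs_aseries (\<lambda>a. y (s * a))) a = y (s * a)" for a
    by (simp add: coeff_Abs_aseries)
  show ?thesis
    by (rule that[of "Abs_aseries (\<lambda>a. y (s * a))"]) (auto simp: series_of_def h y)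
qed

lemma monomial_component:
  "monomial K (component c K) a = series_of k K (monom c (s * a))"
  by (auto simp: monomial_def series_of_def)

lemma series_of_add: "(\<lambda>a. series_of k K f a \<oplus>\<^bsub>K\<^esub> series_of k K g a) = series_of k K (f + g)"
  by (simp add: series_of_def)

lemma series_of_zero: "series_of k K 0 = (\<lambda>_. \<zero>\<^bsub>K\<^esub>)"
  by (simp add: series_of_def)

lemma series_of_one: "series_of k K 1 = monomial K \<one>\<^bsub>K\<^esub> 0"
  using monomial_component[of 1 0] by (simp add: one_aseries_def)

lemma series_of_mult:
  "series_mult K (series_of k K f) (series_of k K g) = series_of k K (f * g)"
proof
  fix e
  define C where "C = {c. coeff f c \<noteq> 0 \<and> coeff g (s * e - c) \<noteq> 0}"
  define \<iota> where "\<iota> c = (s * c, e - s * c)" for c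
  have inj: "inj_on \<iota> C" by (auto simp: \<iota>_def inj_on_def)
  have "series_mult K (series_of k K f) (series_of k K g) e
      = component (\<Sum>(a, b)\<in>\<iota> ` C. coeff f (s * a) * coeff g (s * b)) K"
    unfolding series_mult_def
  proof (rule fsum_component[OF K])
    show "finite (\<iota> ` C)" by (simp add: C_def finite_mult_support)
    show "(case i of (a, b) \<Rightarrow> series_of k K f a \<otimes>\<^bsub>K\<^esub> series_of k K g b) = \<zero>\<^bsub>K\<^esub>"
      if i_in: "i \<in> {(a, b). a + b = e}" and "i \<notin> \<iota> ` C" for i
    proof -
      obtain a b where i: "i = (a, b)" "a + b = e" using i_in by auto
      have "i = \<iota> (s * a)" using i by (simp add: \<iota>_def)
      then have "s * a \<notin> C" using that by blast
      moreover have "s * e - s * a = s * b" using i(2) by (simp flip: right_diff_distrib)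
      ultimately show ?thesis by (auto simp: i C_def series_of_def)
    qed
  qed (auto simp: \<iota>_def series_of_def)
  also have "(\<Sum>(a, b)\<in>\<iota> ` C. coeff f (s * a) * coeff g (s * b))
      = (\<Sum>c\<in>C. coeff f c * coeff g (s * e - c))"
    by (subst sum.reindex[OF inj]) (simp add: \<iota>_def right_diff_distrib)
  finally show "series_mult K (series_of k K f) (series_of k K g) e = series_of k K (f * g) e"
    by (simp add: series_of_def C_def coeff_mult')
qed

lemma series_deg_series_of:
  assumes "order_ge (s * d) h" "component (coeff h (s * d)) K \<noteq> \<zero>\<^bsub>K\<^esub>"
  shows "series_deg k K (series_of k K h) = d"
proof -
  have ge: "s * d \<le> s * a" if "series_of k K h a \<noteq> \<zero>\<^bsub>K\<^esub>" for a
    using that order_geD[OF assms(1), of "s * a"] by (force simp: series_of_def not_less[symmetric])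
  have d: "series_of k K h d \<noteq> \<zero>\<^bsub>K\<^esub>" using assms(2) by (simp add: series_of_def)
  show ?thesis
  proof (cases k)
    case Artinian
    then show ?thesis
      unfolding series_deg_def using ge d
      by (auto simp: orientation_def intro!: Least_equality)
  next
    case Noetherian
    then show ?thesis
      unfolding series_deg_def using ge d
      by (auto simp: orientation_def intro!: Greatest_equality)
  qed
qed

text \<open>
  Every series with positive real leading coefficient lifts to a series for which real powers are defined.
\<close>

lemma series_of_normal_form:
  assumes f: "f \<in> series_set k K" and deg: "series_deg k K f = d"
    and lead: "f d = const K (of_real r)" and r: "r > 0"
  obtains u where "positive_order u" "f = series_of k K (monom (of_real r) (s * d) * (1 + u))"
proof -
  obtain h where h: "series_of k K h = f" "\<And>a. f a = \<zero>\<^bsub>K\<^esub> \<Longrightarrow> coeff h (s * a) = 0"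
    "coeff h (s * d) = of_real r"
    using ex_series_of[OF f, of d r] lead r by (metis less_irrefl)
  have "h \<noteq> 0" using h(3) r by (metis coeff_zero less_irrefl of_real_eq_0_iff)
  then obtain c where c: "coeff h c \<noteq> 0" "order_ge c h" by (rule ex_leading)
  have "f (s * c) \<noteq> \<zero>\<^bsub>K\<^esub>" using h(2)[of "s * c"] c(1) by auto
  then have "component (coeff h c) K \<noteq> \<zero>\<^bsub>K\<^esub>" using h(1) by (auto simp: series_of_def)
  then have "series_deg k K f = s * c"
    using series_deg_series_of[of "s * c" h] c(2) h(1) by simp
  then have ord: "order_ge (s * d) h" using c(2) deg by auto
  define u where "u = monom (of_real (1 / r)) (- (s * d)) * h - 1"
  have "positive_order u"
    using order_geD[OF ord] h(3) r
    by (auto simp: positive_order_def u_def coeff_one simp flip: of_real_mult)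
  moreover have "monom (of_real r) (s * d) * (1 + u) = h"
    using r by (simp add: u_def monom_mult_monom flip: mult.assoc of_real_mult one_aseries_def)
  ultimately show ?thesis using that h(1) by metis
qed

lemma normal_form_lead:
  assumes u: "positive_order u" and r: "r > 0"
  shows "series_deg k K (series_of k K (monom (of_real r) (s * d) * (1 + u))) = d"
    "series_of k K (monom (of_real r) (s * d) * (1 + u)) d = const K (of_real r)"
proof -
  let ?h = "monom (of_real r) (s * d) * (1 + u) :: ring_product aseries"
  have u0: "coeff u 0 = 0" using u by (simp add: positive_order_def)
  then have c: "coeff ?h (s * d) = of_real r" by (simp add: coeff_one)
  show "series_of k K ?h d = const K (of_real r)" using u0 by (simp add: series_of_def coeff_one)
  show "series_deg k K (series_of k K ?h) = d"
  proof (rule series_deg_series_of)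
    show "order_ge (s * d) ?h"
      using u by (auto simp: order_ge_def positive_order_def coeff_one)
    show "component (coeff ?h (s * d)) K \<noteq> \<zero>\<^bsub>K\<^esub>"
      using r const_of_real_neq_zero[of r] unfolding c by simp
  qed
qed

text \<open>
  Multisets of exponents are reflected elementwise; this changes neither the binomial coefficient nor the product of
  the coefficients.
\<close>

lemma series_sum_binomial:
  assumes u: "positive_order u"
  shows "series_sum K (\<lambda>M. monomial K (const K (of_real (mset_binomial t M)) \<otimes>\<^bsub>K\<^esub>
        (\<Otimes>\<^bsub>K\<^esub>a\<in>set_mset M. component (coeff u (s * a)) K [^]\<^bsub>K\<^esub> count M a)) (\<Sum>\<^sub># M)) {M. 0 \<notin># M}
    = series_of k K (binomial_series t u)"
proof
  fix e
  \<comment> \<open>J consists of the multisets whose term at exponent e can be nonzero.\<close>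
  define g where "g M = mset_binomial t M *\<^sub>R (\<Prod>a\<in>#M. coeff u (s * a))" for M
  define J where "J = image_mset (\<lambda>a. s * a) ` exponent_msets u (s * e)"
  have inj: "inj (\<lambda>a. s * a)" by (simp add: inj_def)
  have component_g: "const K (of_real (mset_binomial t M)) \<otimes>\<^bsub>K\<^esub>
      (\<Otimes>\<^bsub>K\<^esub>a\<in>set_mset M. component (coeff u (s * a)) K [^]\<^bsub>K\<^esub> count M a) = component (g M) K" for M
    unfolding g_def image_prod_mset_multiplicity
    by (simp add: component_prod[OF K] component_power[OF K])
  have sum_image: "(\<Sum>a\<in>#M. s * a) = s * \<Sum>\<^sub># M" for M
    by (induction M) (simp_all add: distrib_left)
  have "series_sum K (\<lambda>M. monomial K (const K (of_real (mset_binomial t M)) \<otimes>\<^bsub>K\<^esub>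
        (\<Otimes>\<^bsub>K\<^esub>a\<in>set_mset M. component (coeff u (s * a)) K [^]\<^bsub>K\<^esub> count M a)) (\<Sum>\<^sub># M)) {M. 0 \<notin># M} e
    = component (sum g J) K"
    unfolding series_sum_def component_g
  proof (rule fsum_component[OF K])
    show "finite J" by (simp add: J_def finite_exponent_msets[OF u])
    show "J \<subseteq> {M. 0 \<notin># M}"
    proof -
      have "coeff u 0 = 0" using u by (simp add: positive_order_def)
      then show ?thesis by (fastforce simp: J_def exponent_msets_def)
    qed
    show "monomial K (component (g M) K) (\<Sum>\<^sub># M) e = component (g M) K" if "M \<in> J" for M
      using that by (auto simp: J_def exponent_msets_def monomial_def sum_image)
    show "monomial K (component (g M) K) (\<Sum>\<^sub># M) e = \<zero>\<^bsub>K\<^esub>" if "M \<notin> J" for M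
    proof (cases "\<exists>a\<in>#M. coeff u (s * a) = 0")
      case True
      then obtain a N where "M = add_mset a N" "coeff u (s * a) = 0"
        by (blast dest: multi_member_split)
      then show ?thesis by (simp add: g_def monomial_def)
    next
      case False
      have M: "M = image_mset (\<lambda>a. s * a) (image_mset (\<lambda>a. s * a) M)"
        by (simp add: image_mset.compositionality o_def)
      have "image_mset (\<lambda>a. s * a) M \<notin> exponent_msets u (s * e)"
        using that M unfolding J_def by blast
      then have "\<Sum>\<^sub># M \<noteq> e" using False by (auto simp: exponent_msets_def sum_image)
      then show ?thesis by (simp add: monomial_def)
    qed
  qed
  also have "sum g J = (\<Sum>M\<in>exponent_msets u (s * e). g (image_mset (\<lambda>a. s * a) M))"
    unfolding J_def
  proof (rule sum.reindex_cong[OF _ refl refl])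
    show "inj_on (image_mset (\<lambda>a. s * a)) (exponent_msets u (s * e))"
      by (rule inj_on_inverseI[of _ "image_mset (\<lambda>a. s * a)"])
         (simp add: image_mset.compositionality o_def)
  qed
  also have "\<dots> = coeff (binomial_series t u) (s * e)"
    unfolding g_def mset_binomial_image_inj[OF inj] binomial_series_def coeff_mset_series[OF u]
    by (simp add: image_mset.compositionality o_def)
  finally show "series_sum K (\<lambda>M. monomial K (const K (of_real (mset_binomial t M)) \<otimes>\<^bsub>K\<^esub>
        (\<Otimes>\<^bsub>K\<^esub>a\<in>set_mset M. component (coeff u (s * a)) K [^]\<^bsub>K\<^esub> count M a)) (\<Sum>\<^sub># M)) {M. 0 \<notin># M} e
    = series_of k K (binomial_series t u) e"
    by (simp add: series_of_def)
qed

lemma series_pow_series_of: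
  assumes u: "positive_order u" and r: "r > 0"
    and f: "f = series_of k K (monom (of_real r) (s * d) * (1 + u))"
  shows "series_pow k K f t 0 = series_of k K (powers (s * d) r u t)"
proof -
  have deg: "series_deg k K f = d" and fd: "f d = const K (of_real r)"
    using normal_form_lead[OF u r] f by auto
  have ratio: "f (a + d) \<otimes>\<^bsub>K\<^esub> inv\<^bsub>K\<^esub> const K (of_real r) = component (coeff u (s * a)) K" if "a \<noteq> 0" for a
  proof -
    have "f (a + d) = component (of_real r * coeff u (s * a)) K"
      using that by (simp add: f series_of_def distrib_left coeff_one)
    then have "f (a + d) \<otimes>\<^bsub>K\<^esub> inv\<^bsub>K\<^esub> const K (of_real r)
        = component (of_real r * coeff u (s * a) * of_real (1 / r)) K"
      using r by (simp add: inv_const del: of_real_divide)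
    also have "of_real r * coeff u (s * a) * of_real (1 / r) = of_real (r * (1 / r)) * coeff u (s * a)"
      by (simp only: of_real_mult mult_ac)
    finally show ?thesis using r by simp
  qed
  have "(\<Otimes>\<^bsub>K\<^esub>a\<in>set_mset M. (f (a + d) \<otimes>\<^bsub>K\<^esub> inv\<^bsub>K\<^esub> f d) [^]\<^bsub>K\<^esub> count M a)
      = (\<Otimes>\<^bsub>K\<^esub>a\<in>set_mset M. component (coeff u (s * a)) K [^]\<^bsub>K\<^esub> count M a)" if "0 \<notin># M" for M
  proof (rule finprod_cong')
    fix a assume "a \<in> set_mset M"
    then have "a \<noteq> 0" using that by auto
    then show "(f (a + d) \<otimes>\<^bsub>K\<^esub> inv\<^bsub>K\<^esub> f d) [^]\<^bsub>K\<^esub> count M a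
        = component (coeff u (s * a)) K [^]\<^bsub>K\<^esub> count M a"
      by (simp add: fd ratio)
  qed auto
  then have "series_sum K (\<lambda>M. monomial K (const K (of_real (mset_binomial t M)) \<otimes>\<^bsub>K\<^esub>
        (\<Otimes>\<^bsub>K\<^esub>a\<in>set_mset M. (f (a + d) \<otimes>\<^bsub>K\<^esub> inv\<^bsub>K\<^esub> f d) [^]\<^bsub>K\<^esub> count M a)) (\<Sum>\<^sub># M)) {M. 0 \<notin># M}
    = series_sum K (\<lambda>M. monomial K (const K (of_real (mset_binomial t M)) \<otimes>\<^bsub>K\<^esub>
        (\<Otimes>\<^bsub>K\<^esub>a\<in>set_mset M. component (coeff u (s * a)) K [^]\<^bsub>K\<^esub> count M a)) (\<Sum>\<^sub># M)) {M. 0 \<notin># M}"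
    unfolding series_sum_def fsum_def
    by (intro ext add.finprod_cong') (auto simp: monomial_def component_prod[OF K, symmetric] component_power[OF K, symmetric])
  also have "\<dots> = series_of k K (binomial_series t u)"
    by (rule series_sum_binomial[OF u])
  finally have sum: "series_sum K (\<lambda>M. monomial K (const K (of_real (mset_binomial t M)) \<otimes>\<^bsub>K\<^esub>
        (\<Otimes>\<^bsub>K\<^esub>a\<in>set_mset M. (f (a + d) \<otimes>\<^bsub>K\<^esub> inv\<^bsub>K\<^esub> f d) [^]\<^bsub>K\<^esub> count M a)) (\<Sum>\<^sub># M)) {M. 0 \<notin># M}
    = series_of k K (binomial_series t u)" .
  have "monomial K (gpow K (f d) t 0) (d * t)
      = series_of k K (monom (of_real (r powr t)) (s * d * t))"
    using monomial_component[of "of_real (r powr t)" "d * t"] by (simp add: fd gpow_const[OF r] mult.assoc)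
  then show ?thesis
    unfolding series_pow_def deg Let_def sum by (simp add: series_of_mult powers_def)
qed

lemma ex_component_series:
  assumes "f \<in> series_set k K"
  obtains h where "f = series_of k K h"
  using ex_series_of[OF assms] by metis

lemma series_field_simps:
  "carrier (series_field k K) = range (series_of k K)"
  "series_of k K f \<otimes>\<^bsub>series_field k K\<^esub> series_of k K g = series_of k K (f * g)"
  "series_of k K f \<oplus>\<^bsub>series_field k K\<^esub> series_of k K g = series_of k K (f + g)"
  "\<one>\<^bsub>series_field k K\<^esub> = series_of k K 1"
  "\<zero>\<^bsub>series_field k K\<^esub> = series_of k K 0"
proof -
  show "carrier (series_field k K) = range (series_of k K)"
  proof
    show "carrier (series_field k K) \<subseteq> range (series_of k K)"
    proof
      fix f assume "f \<in> carrier (series_field k K)"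
      then have "f \<in> series_set k K" by (simp add: series_field_def)
      then obtain h where "f = series_of k K h" by (rule ex_component_series)
      then show "f \<in> range (series_of k K)" by (rule image_eqI) simp
    qed
    show "range (series_of k K) \<subseteq> carrier (series_field k K)"
      using series_of_closed by (auto simp: series_field_def)
  qed
qed (simp_all add: series_field_def series_of_mult series_of_add series_of_one series_of_zero)

text \<open>
  The ring axioms hold because \<open>series_of\<close> maps the typed ring of series onto \<open>series_field k K\<close>, compatibly with the
  operations.
\<close>

lemma coefficient_ring_series_field: "coefficient_ring (series_field k K)"
proof -
  let ?S = "series_field k K"
  have "cring ?S"
  proof (rule cringI)
    show "abelian_group ?S"
    proof (rule abelian_groupI)
      fix x assume "x \<in> carrier ?S"
      then obtain h where "x = series_of k K h" by (auto simp: series_field_simps)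
      then show "\<exists>y\<in>carrier ?S. y \<oplus>\<^bsub>?S\<^esub> x = \<zero>\<^bsub>?S\<^esub>"
        by (intro bexI[of _ "series_of k K (- h)"]) (auto simp: series_field_simps)
    qed (auto simp: series_field_simps add_ac)
    show "comm_monoid ?S"
      by (rule comm_monoidI) (auto simp: series_field_simps mult_ac)
  qed (auto simp: series_field_simps distrib_right)
  moreover have "\<one>\<^bsub>?S\<^esub> \<noteq> \<zero>\<^bsub>?S\<^esub>"
    using one_neq_zero by (auto simp: series_field_def monomial_def dest: fun_cong[of _ _ 0])
  moreover have const: "\<exists>y. component y K = const K z \<and> const ?S z = series_of k K (monom y 0)" for z
  proof -
    obtain y where "component y K = const K z" using ex_component[OF K const_closed] by blast
    then show ?thesis using monomial_component[of y 0] by (auto simp: series_field_def)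
  qed
  moreover have "const ?S z \<in> carrier ?S" for z
    using const[of z] by (auto simp: series_field_simps)
  moreover have "const ?S 1 = \<one>\<^bsub>?S\<^esub>" by (simp add: series_field_def)
  moreover have "const ?S (z + w) = const ?S z \<oplus>\<^bsub>?S\<^esub> const ?S w" for z w
    by (auto simp: series_field_def monomial_def const_add)
  moreover have "const ?S (z * w) = const ?S z \<otimes>\<^bsub>?S\<^esub> const ?S w" for z w
  proof -
    obtain y y' where y: "component y K = const K z" "const ?S z = series_of k K (monom y 0)"
      "component y' K = const K w" "const ?S w = series_of k K (monom y' 0)"
      using const by metis
    have "const ?S (z * w) = monomial K (component (y * y') K) 0"
      by (simp add: series_field_def const_mult y)
    also have "\<dots> = series_of k K (monom (y * y') 0)"
      using monomial_component[of "y * y'" 0] by simp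
    finally show ?thesis unfolding y series_field_simps by (simp add: monom_mult_monom)
  qed
  moreover have "gpow ?S (const ?S (of_real r)) t 0 = const ?S (of_real (r powr t))" if r: "r > 0" for r t
  proof -
    have const_monom: "const ?S (of_real c) = series_of k K (monom (of_real c) 0)" for c
      using monomial_component[of "of_real c" 0] by (simp add: series_field_def)
    have u: "positive_order (0 :: ring_product aseries)" by (simp add: positive_order_def)
    have "binomial_series t (0 :: ring_product aseries) = 1"
      by (rule binomial_series_unique[OF u, symmetric]) (auto simp: coeff_one)
    then show ?thesis
      using series_pow_series_of[OF u r, of "const ?S (of_real r)" 0 t]
      by (simp add: const_monom powers_def) (simp add: series_field_def)
  qed
  ultimately show ?thesis
    unfolding coefficient_ring_def coefficient_ring_axioms_def by auto
qed

lemma series_compose_series_of: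
  assumes "power_group A \<rho> logder \<Gamma>"
    and pow: "\<And>a. series_pow k K f a 0 = series_of k K (A (s * a))"
  shows "series_compose k K (series_of k K h) f 0 = series_of k K (substitute A h)"
proof
  interpret A: power_group A \<rho> logder \<Gamma> by fact
  fix e
  define J where "J = {b. b \<le> s * e \<and> coeff h b \<noteq> 0}"
  have "series_compose k K (series_of k K h) f 0 e
      = component (\<Sum>a\<in>(\<lambda>b. s * b) ` J. coeff h (s * a) * coeff (A (s * a)) (s * e)) K"
    unfolding series_compose_def series_sum_def pow
  proof (rule fsum_component[OF K])
    show "finite ((\<lambda>b. s * b) ` J)" by (simp add: J_def finite_coeff)
    fix a assume "a \<notin> (\<lambda>b. s * b) ` J"
    then have "s * a \<notin> J" by (metis image_eqI orientation_square(2))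
    then have "coeff h (s * a) = 0 \<or> coeff (A (s * a)) (s * e) = 0"
      using order_geD[OF A.order_ge_A, of "s * e" "s * a"] by (auto simp: J_def)
    then show "series_of k K h a \<otimes>\<^bsub>K\<^esub> series_of k K (A (s * a)) e = \<zero>\<^bsub>K\<^esub>"
      by (auto simp: series_of_def)
  qed (auto simp: series_of_def)
  also have "(\<Sum>a\<in>(\<lambda>b. s * b) ` J. coeff h (s * a) * coeff (A (s * a)) (s * e))
      = (\<Sum>b\<in>J. coeff h b * coeff (A b) (s * e))"
    by (subst sum.reindex) (auto simp: inj_on_def)
  also have "\<dots> = coeff (substitute A h) (s * e)"
    by (rule A.coeff_substitute[symmetric]) (auto simp: J_def finite_coeff)
  finally show "series_compose k K (series_of k K h) f 0 e = series_of k K (substitute A h) e"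
    by (simp add: series_of_def)
qed

end

section \<open>The inversion formula\<close>

lemma coefficient_ring_coeff_field: "coefficient_ring (coeff_field ks)"
  by (induction ks)
     (simp_all add: coefficient_ring_transport coefficient_ring_complex coefficient_ring_series_field)

text \<open>
  For \<open>f = r x (1 + u)\<close>, let \<open>A a\<close> be the lift of \<open>f\<^sup>s\<^sup>a\<close>, and \<open>F\<close> the solution of \<open>F(f) = x\<close>. In lifted form, \<open>f\<close> is \<open>A s\<close> and
  the variable \<open>x\<close> is \<open>x\<^sup>s\<close>. Once \<open>F\<close> is known to be the inverse of \<open>f\<close>, both sides of the formula are coefficients
  of \<open>f\<^sup>-\<^sup>a\<close>.
\<close>

lemma lagrange_inversion_real_powers:
  fixes K :: "nested power_ring" and k :: kind
  assumes K: "coefficient_ring K" and f: "delta_series k K f"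
    and r: "r > 0" and lead: "series_lead k K f = const K (of_real r)"
  shows "const K (of_real a) \<otimes>\<^bsub>K\<^esub> series_pow k K (comp_inverse k K f) b 0 a
    = const K (of_real b) \<otimes>\<^bsub>K\<^esub>
      series_pow k K (var K \<otimes>\<^bsub>series_field k K\<^esub> inv\<^bsub>series_field k K\<^esub> f) a 0 (a - b)"
proof -
  interpret coefficient_ring K by (rule K)
  interpret S: coefficient_ring "series_field k K" by (rule coefficient_ring_series_field[OF K])
  define s where "s = orientation k"
  have ss: "s * s = 1" "s * (s * c) = c" "s \<noteq> 0" for c by (simp_all add: s_def)
  note S = series_field_simps[OF K]

  have f_in: "f \<in> series_set k K" and deg_f: "series_deg k K f = 1"
    using f by (auto simp: delta_series_def series_field_def)
  have "f 1 = const K (of_real r)" using lead deg_f by (simp add: series_lead_def)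
  then obtain u where u: "positive_order u"
    and f_u: "f = series_of k K (monom (of_real r) (orientation k * 1) * (1 + u))"
    using series_of_normal_form[OF K f_in deg_f _ r] by blast
  define A where "A c = powers s r u (s * c)" for c
  obtain logderA where A: "power_group A (r powr s) logderA (exponent_monoid u)"
    using power_group_powers[OF r u ss(1)] unfolding A_def by blast
  interpret A: power_group A "r powr s" logderA "exponent_monoid u" by (rule A)
  have f_A: "f = series_of k K (A s)"
    using f_u by (simp add: A_def ss(1) powers_1[OF r u] flip: s_def)
  have pow_f: "series_pow k K f c 0 = series_of k K (A (orientation k * c))" for c
    using series_pow_series_of[OF K u r f_u] by (simp add: A_def ss flip: s_def)

  obtain F where F: "substitute A F = monom 1 s"
    by (rule A.ex_substitute_eq_monom)
  have ord_F: "order_ge s F"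
    by (rule A.order_ge_substituteD) (simp add: F order_ge_monom)
  have "s *\<^sub>R coeff F s = s *\<^sub>R of_real ((r powr s) powr (- s))"
    using A.lagrange_inversion[OF F, of s] A.leading_A[of "- s"] by simp
  also have "(r powr s) powr (- s) = 1 / r"
    using r by (simp add: powr_powr ss(1) powr_minus_divide)
  finally have lead_F: "coeff F s = of_real (1 / r)" using ss(3) by simp
  define v where "v = monom (of_real r) (- s) * F - 1"
  have v: "positive_order v"
    using order_geD[OF ord_F] lead_F r
    by (auto simp: positive_order_def v_def coeff_one simp flip: of_real_mult)
  have r': "1 / r > 0" using r by simp
  have F_v: "F = monom (of_real (1 / r)) s * (1 + v)"
    using r by (simp add: v_def monom_mult_monom flip: mult.assoc of_real_mult one_aseries_def)
  define B where "B c = powers s (1 / r) v (s * c)" for c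
  obtain logderB where B: "power_group B ((1 / r) powr s) logderB (exponent_monoid v)"
    using power_group_powers[OF r' v ss(1)] unfolding B_def by blast
  have B_s: "B s = F"
    unfolding B_def ss(1) powers_1[OF r' v] F_v[symmetric] ..
  have sub_B: "substitute A (B c) = monom 1 c" for c
  proof (rule substitute_inverse_powers[OF A B ss(3)])
    show "substitute A (B s) = monom 1 s" by (simp add: B_s F)
    show "(1 / r) powr s * r powr s = 1" using r by (simp flip: powr_mult)
  qed
  have inverse: "substitute B (substitute A h) = h" for h
    using substitute_inverse(2)[OF A B] sub_B by blast
  define G where "G = series_of k K F"
  have G_v: "G = series_of k K (monom (of_real (1 / r)) (orientation k * 1) * (1 + v))"
    unfolding G_def by (subst F_v) (simp add: s_def)
  have pow_G: "series_pow k K G c 0 = series_of k K (B (orientation k * c))" for c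
    using series_pow_series_of[OF K v r' G_v] by (simp add: B_def ss flip: s_def)
  have var: "var K = series_of k K (monom 1 s)"
    using monomial_component[OF K, of 1 1] component_ops(2)[OF K] by (simp add: s_def)
  note compose_f = series_compose_series_of[OF K A pow_f]
  note compose_G = series_compose_series_of[OF K B pow_G]

  have "comp_inverse k K f = G"
    unfolding comp_inverse_def
  proof (rule the_equality, intro conjI)
    have "series_deg k K G = 1" "G 1 = const K (of_real (1 / r))"
      using normal_form_lead[OF K v r'] unfolding G_v by blast+
    then show "delta_series k K G"
      using const_of_real_neq_zero[of "1 / r"] r' S(1,5)
      by (auto simp: delta_series_def G_def series_of_zero[OF K])
    show "series_compose k K G f 0 = var K"
      by (simp add: G_def compose_f F var)
    show "series_compose k K f G 0 = var K"
      using inverse[of "monom 1 s"]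
      by (simp add: f_A compose_G var A.substitute_monom flip: one_aseries_def)
  next
    \<comment> \<open>Uniqueness: H = (H o f) o F = x o F = F, where composition with f and then with F is
      the identity on every series.\<close>
    fix H assume H: "delta_series k K H \<and> series_compose k K H f 0 = var K
      \<and> series_compose k K f H 0 = var K"
    then obtain h where h: "H = series_of k K h"
      using S(1) by (auto simp: delta_series_def)
    have "series_of k K (substitute A h) = var K" using H h compose_f by metis
    then have "series_compose k K (series_of k K (substitute A h)) G 0
        = series_compose k K (series_of k K (monom 1 s)) G 0"
      by (simp add: var)
    then have "series_of k K (substitute B (substitute A h))
        = series_of k K (substitute B (substitute A F))"
      by (simp add: compose_G F)
    then show "H = G" by (simp add: inverse h G_def)
  qed
  then have "const K (of_real a) \<otimes>\<^bsub>K\<^esub> series_pow k K (comp_inverse k K f) b 0 a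
      = component (a *\<^sub>R coeff (B (s * b)) (s * a)) K"
    by (simp add: pow_G component_ops[OF K] s_def) (simp add: series_of_def)
  also have "a *\<^sub>R coeff (B (s * b)) (s * a) = s *\<^sub>R ((s * a) *\<^sub>R coeff (B (s * b)) (s * a))"
    by (simp add: ss)
  also have "\<dots> = b *\<^sub>R coeff (A (- (s * a))) (- (s * b))"
    unfolding A.lagrange_inversion[OF sub_B] by (simp add: ss)
  also have "A (- (s * a)) = powers s r u (- a)" by (simp add: A_def ss)
  also have "coeff (powers s r u (- a)) (- (s * b))
      = of_real (r powr (- a)) * coeff (binomial_series (- a) u) (s * (a - b))"
    by (simp add: powers_def right_diff_distrib)
  finally have lhs: "const K (of_real a) \<otimes>\<^bsub>K\<^esub> series_pow k K (comp_inverse k K f) b 0 a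
      = component (b *\<^sub>R (of_real (r powr (- a)) * coeff (binomial_series (- a) u) (s * (a - b)))) K" .

  \<comment> \<open>The series x / f is (1 + w) / r.\<close>
  define w where "w = binomial_series (- 1) u - 1"
  have w: "positive_order w"
    unfolding w_def
    by (rule positive_order_minus_one[OF order_ge_binomial_series[OF u] coeff_binomial_series_0[OF u]])
  have "inv\<^bsub>series_field k K\<^esub> f = series_of k K (A (- s))"
    by (rule S.comm_inv_char) (auto simp: f_A S A.A_uminus)
  then have "var K \<otimes>\<^bsub>series_field k K\<^esub> inv\<^bsub>series_field k K\<^esub> f
      = series_of k K (monom 1 s * A (- s))"
    by (simp add: var S)
  also have "monom 1 s * A (- s) = monom (of_real (1 / r)) (orientation k * 0) * (1 + w)"
    using r by (simp add: A_def powers_def w_def ss powr_minus_divide monom_mult_monom flip: mult.assoc)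
  finally have "series_pow k K (var K \<otimes>\<^bsub>series_field k K\<^esub> inv\<^bsub>series_field k K\<^esub> f) a 0
      = series_of k K (powers (orientation k * 0) (1 / r) w a)"
    by (rule series_pow_series_of[OF K w r'])
  also have "powers (orientation k * 0) (1 / r) w a
      = monom (of_real (r powr (- a))) 0 * binomial_series (- a) u"
    using r by (simp add: powers_def w_def binomial_series_power[OF u] powr_divide powr_minus_divide)
  finally have "series_pow k K (var K \<otimes>\<^bsub>series_field k K\<^esub> inv\<^bsub>series_field k K\<^esub> f) a 0 (a - b)
      = component (of_real (r powr (- a)) * coeff (binomial_series (- a) u) (s * (a - b))) K"
    by (simp add: series_of_def s_def)
  then show ?thesis
    unfolding lhs by (simp add: component_ops[OF K])
qed

theorem theorem3p2:
  fixes ks :: "kind list" and k :: kind and f :: "real \<Rightarrow> nested" and a b :: real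
  defines "K \<equiv> coeff_field ks"
  defines "S \<equiv> series_field k K"
  assumes "delta_series k K f"
    and "\<exists>r::real. r > 0 \<and> series_lead k K f = const K (of_real r)"
  shows "const K (of_real a) \<otimes>\<^bsub>K\<^esub> (series_pow k K (comp_inverse k K f) b 0) a
       = const K (of_real b) \<otimes>\<^bsub>K\<^esub> (series_pow k K (var K \<otimes>\<^bsub>S\<^esub> inv\<^bsub>S\<^esub> f) a 0) (a - b)"
proof -
  have "coefficient_ring K" unfolding K_def by (rule coefficient_ring_coeff_field)
  then show ?thesis
    using lagrange_inversion_real_powers assms(3,4) unfolding S_def by blast
qed

end
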